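(* Let $(\sigma_h^{n+1},u_h^{n+1},\gamma_h^{n+1},z_h^{n+1},p_h^{n+1})_{0\le n\le N-1}$ be the solution of the fixed stress scheme: $(\sigma_h^{n+1},u_h^{n+1},\gamma_h^{n+1},z_h^{n+1},p_h^{n+1})\in\mathbb{X}_h\times V_h\times\mathbb{Q}_h\times Z_h\times W_h$ satisfy, for $n=-1,0,\dots,N-1$, $$\begin{aligned} &(K^{-1}z_h^{n+1},q)-(p_h^{n+1},\mathrm{div}\,q)=0&&\forall q\in Z_h,\\ &(A\sigma_h^{n+1},\tau)+(u_h^{n+1},\mathrm{div}\,\tau)+(\gamma_h^{n+1},\tau)=-(A\alpha p_h^{n+1}I,\tau)&&\forall\tau\in\mathbb{X}_h,\\ &(\mathrm{div}\,\sigma_h^{n+1},v)=0&&\forall v\in V_h,\\ &(\sigma_h^{n+1},\xi)=0&&\forall\xi\in\mathbb{Q}_h, \end{aligned}$$ and, for $n=0,\dots,N-1$ with $\sigma_h^{-1}:=\sigma_h^0$ and all $w\in W_h$, $$c_0\Big(\frac{p_h^{n+1}-p_h^n}{\Delta t},w\Big)+\alpha\Big(A\alpha\frac{p_h^{n+1}-p_h^n}{\Delta t}I,wI\Big)+(\mathrm{div}\,z_h^{n+1},w)=-\alpha\Big(A\frac{\sigma_h^{n}-\sigma_h^{n-1}}{\Delta t},wI\Big).$$ Then there exists a constant $C$ independent of $h$, $\Delta t$, $c_0$, and $a_{\min}$ such that $$\sum_{n=0}^{N-1}\frac{c_0}{\Delta t}\|p_h^{n+1}-p_h^n\|^2+\max_{0\le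 n\le N-1}\Big(\|z_h^{n+1}\|^2+\|p_h^{n+1}\|^2+\|A^{1/2}\sigma_h^{n+1}\|^2+\|u_h^{n+1}\|^2+\|\gamma_h^{n+1}\|^2\Big)\le C\|z_h^0\|^2.$$
   Context: $\Omega\subset\mathbb{R}^d$, $d=2,3$, is a simply connected Lipschitz polygonal domain with $\partial\Omega=\Gamma_D^u\cup\Gamma_N^\sigma=\Gamma_D^p\cup\Gamma_N^z$. $\mathbb{M},\mathbb{S},\mathbb{N}$ are the real $d\times d$ matrices, symmetric matrices, and skew-symmetric matrices. $(\cdot,\cdot)$ and $\|\cdot\|$ are the $L^2(\Omega)$ inner product and norm (scalar, vector or matrix valued); $\mathrm{div}$ of a matrix field is taken row-wise; $\|\tau\|_{\mathrm{div}}^2=\|\tau\|^2+\|\mathrm{div}\,\tau\|^2$; $I$ is the $d\times d$ identity. $A$ (compliance tensor) is a symmetric, bounded, uniformly positive definite linear operator on $\mathbb{S}$, extended to $\mathbb{M}$, and $K$ (permeability) is a symmetric, bounded, uniformly positive definite tensor: there are constants $0<a_{\min}\le a_{\max}<\infty$, $0<k_{\min}\le k_{\max}<\infty$ with $a_{\min}\|\tau\|^2\le(A\tau,\tau)\le a_{\max}\|\tau\|^2$ for all $\tau\in\mathbb{X}$ and $k_{\min}\|q\|^2\le(Kq,q)\le k_{\max}\|q\|^2$ for all $q\in Z$. Also $c_0\ge0$, $0<\alpha\le1$, and $\Delta t=T/N$ is the time step. Spaces: $\mathbb{X}=\{\tau\in H(\mathrm{div};\Omega,\mathbb{M}):\tau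 n=0\text{ on }\Gamma_N^\sigma\}$, $V=L^2(\Omega,\mathbb{R}^d)$, $\mathbb{Q}=L^2(\Omega,\mathbb{N})$, $Z=\{q\in H(\mathrm{div};\Omega):q\cdot n=0\text{ on }\Gamma_N^z\}$, $W=L^2(\Omega)$, where $n$ here denotes the outward unit normal on $\partial\Omega$. $\mathbb{X}_h\times V_h\times\mathbb{Q}_h\times Z_h\times W_h\subset\mathbb{X}\times V\times\mathbb{Q}\times Z\times W$ are finite element spaces on a shape-regular quasi-uniform family of partitions $\mathcal T_h$ of $\Omega$ with mesh size $h$, satisfying the inf-sup conditions, with constants independent of $h$, $$\|v\|+\|\xi\|\le C\sup_{0\ne\tau\in\mathbb{X}_h}\frac{(v,\mathrm{div}\,\tau)+(\xi,\tau)}{\|\tau\|_{\mathrm{div}}}\ \ \forall v\in V_h,\xi\in\mathbb{Q}_h,\qquad \|w\|\le C\sup_{0\ne q\in Z_h}\frac{(\mathrm{div}\,q,w)}{\|q\|_{\mathrm{div}}}\ \ \forall w\in W_h.$$ $p_h^0\in W_h$ is the given discrete initial pressure. Source terms and boundary data are zero. Solving the first four equations with $n=-1$ provides the initial data $\sigma_h^0,u_h^0,\gamma_h^0,z_h^0$. *)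

theory Defs
  imports "HOL-Analysis.Analysis"
begin

section \<open>Domain\<close>

text \<open>Near each boundary point, \<open>\<Omega>\<close> is the set above the graph, in direction \<open>e\<close>, of a Lipschitz
  function of the component orthogonal to \<open>e\<close>.\<close>

definition lipschitz_boundary :: "'a::euclidean_space set \<Rightarrow> bool" where
  "lipschitz_boundary \<Omega> \<longleftrightarrow>
     (\<forall>x0\<in>frontier \<Omega>. \<exists>r>0. \<exists>e L. \<exists>\<psi> :: 'a \<Rightarrow> real.
        norm e = 1 \<and> L-lipschitz_on UNIV \<psi> \<and>
        (\<forall>x\<in>ball x0 r. x \<in> \<Omega> \<longleftrightarrow> \<psi> (x - (x \<bullet> e) *\<^sub>R e) < x \<bullet> e))"

definition lipschitz_polygonal_domain :: "'a::euclidean_space set \<Rightarrow> bool" where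
  "lipschitz_polygonal_domain \<Omega> \<longleftrightarrow>
     \<Omega> \<noteq> {} \<and> open \<Omega> \<and> bounded \<Omega> \<and> connected \<Omega> \<and> lipschitz_boundary \<Omega> \<and>
     (\<exists>P. finite P \<and> (\<forall>S\<in>P. polytope S) \<and> closure \<Omega> = \<Union>P)"

section \<open>Function spaces\<close>

text \<open>An element of a Lebesgue space is represented by a function on the whole of \<open>\<real>\<^sup>d\<close>, of which only
  the values on \<open>\<Omega>\<close>, up to null sets, matter. Scalar, vector and matrix fields are treated
  uniformly: the inner product and norm of \<open>real^'d^'d\<close> are those of Frobenius.\<close>

definition L2 :: "'a::euclidean_space set \<Rightarrow> ('a \<Rightarrow> 'b::euclidean_space) set" where
  "L2 \<Omega> = {f. f \<in> borel_measurable (lebesgue_on \<Omega>) \<and> integrable (lebesgue_on \<Omega>) (\<lambda>x. (norm (f x))\<^sup>2)}"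

definition l2inner :: "'a::euclidean_space set \<Rightarrow> ('a \<Rightarrow> 'b::euclidean_space) \<Rightarrow> ('a \<Rightarrow> 'b) \<Rightarrow> real" where
  "l2inner \<Omega> f g = (LINT x|lebesgue_on \<Omega>. f x \<bullet> g x)"

definition l2norm :: "'a::euclidean_space set \<Rightarrow> ('a \<Rightarrow> 'b::euclidean_space) \<Rightarrow> real" where
  "l2norm \<Omega> f = sqrt (LINT x|lebesgue_on \<Omega>. (norm (f x))\<^sup>2)"

definition C1c_with_grad :: "('a::euclidean_space \<Rightarrow> real) \<Rightarrow> ('a \<Rightarrow> 'a) \<Rightarrow> bool" where
  "C1c_with_grad \<phi> g \<longleftrightarrow>
     (\<forall>x. GDERIV \<phi> x :> g x) \<and> continuous_on UNIV g \<and> compact (closure {x. \<phi> x \<noteq> 0})"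

definition is_weak_div :: "'a::euclidean_space set \<Rightarrow> ('a \<Rightarrow> 'a) \<Rightarrow> ('a \<Rightarrow> real) \<Rightarrow> bool" where
  "is_weak_div \<Omega> q f \<longleftrightarrow>
     (\<forall>\<phi> g. C1c_with_grad \<phi> g \<and> closure {x. \<phi> x \<noteq> 0} \<subseteq> \<Omega> \<longrightarrow> l2inner \<Omega> q g = - l2inner \<Omega> f \<phi>)"

definition Hdiv :: "'a::euclidean_space set \<Rightarrow> ('a \<Rightarrow> 'a) set" where
  "Hdiv \<Omega> = {q \<in> L2 \<Omega>. \<exists>f\<in>L2 \<Omega>. is_weak_div \<Omega> q f}"

text \<open>For \<open>q\<close> in \<open>Hdiv \<Omega>\<close> the weak divergence is unique up to null sets.\<close>

definition wdiv :: "'a::euclidean_space set \<Rightarrow> ('a \<Rightarrow> 'a) \<Rightarrow> 'a \<Rightarrow> real" where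
  "wdiv \<Omega> q = (SOME f. f \<in> L2 \<Omega> \<and> is_weak_div \<Omega> q f)"

definition wdiv_mat :: "(real^'d) set \<Rightarrow> (real^'d \<Rightarrow> real^'d^'d) \<Rightarrow> real^'d \<Rightarrow> real^'d" where
  "wdiv_mat \<Omega> \<tau> = (\<lambda>x. \<chi> i. wdiv \<Omega> (\<lambda>y. \<tau> y $ i) x)"

text \<open>The normal trace \<open>q \<cdot> n\<close> of an \<open>H(div)\<close> field is the functional
  \<open>\<phi> \<mapsto> (q, \<nabla>\<phi>) + (div q, \<phi>)\<close> of Green's formula; it vanishes on \<open>\<Gamma>\<close> if it annihilates the
  functions whose support meets the boundary only within \<open>\<Gamma>\<close>.\<close>

definition normal_trace_zero_on :: "'a::euclidean_space set \<Rightarrow> 'a set \<Rightarrow> ('a \<Rightarrow> 'a) \<Rightarrow> bool" where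
  "normal_trace_zero_on \<Omega> \<Gamma> q \<longleftrightarrow>
     (\<forall>\<phi> g. C1c_with_grad \<phi> g \<and> closure {x. \<phi> x \<noteq> 0} \<inter> frontier \<Omega> \<subseteq> \<Gamma> \<longrightarrow>
        l2inner \<Omega> q g + l2inner \<Omega> (wdiv \<Omega> q) \<phi> = 0)"

definition velocity_space :: "(real^'d) set \<Rightarrow> (real^'d) set \<Rightarrow> (real^'d \<Rightarrow> real^'d) set" where
  "velocity_space \<Omega> \<Gamma>Nz = {q \<in> Hdiv \<Omega>. normal_trace_zero_on \<Omega> \<Gamma>Nz q}"

definition stress_space :: "(real^'d) set \<Rightarrow> (real^'d) set \<Rightarrow> (real^'d \<Rightarrow> real^'d^'d) set" where
  "stress_space \<Omega> \<Gamma>N\<sigma> =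
     {\<tau>. \<forall>i. (\<lambda>x. \<tau> x $ i) \<in> Hdiv \<Omega> \<and> normal_trace_zero_on \<Omega> \<Gamma>N\<sigma> (\<lambda>x. \<tau> x $ i)}"

definition rotation_space :: "(real^'d) set \<Rightarrow> (real^'d \<Rightarrow> real^'d^'d) set" where
  "rotation_space \<Omega> = {\<xi> \<in> L2 \<Omega>. AE x in lebesgue_on \<Omega>. transpose (\<xi> x) = - \<xi> x}"

definition hdiv_norm :: "(real^'d) set \<Rightarrow> (real^'d \<Rightarrow> real^'d) \<Rightarrow> real" where
  "hdiv_norm \<Omega> q = sqrt ((l2norm \<Omega> q)\<^sup>2 + (l2norm \<Omega> (wdiv \<Omega> q))\<^sup>2)"

definition hdiv_norm_mat :: "(real^'d) set \<Rightarrow> (real^'d \<Rightarrow> real^'d^'d) \<Rightarrow> real" where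
  "hdiv_norm_mat \<Omega> \<tau> = sqrt ((l2norm \<Omega> \<tau>)\<^sup>2 + (l2norm \<Omega> (wdiv_mat \<Omega> \<tau>))\<^sup>2)"

section \<open>Coefficients\<close>

text \<open>Uniform positive definiteness of both tensors is stated separately, by
  \<open>compliance_bounds\<close> and \<open>permeability_bounds\<close>.\<close>

definition compliance_tensor ::
  "(real^'d) set \<Rightarrow> (real^'d \<Rightarrow> real^'d^'d \<Rightarrow> real^'d^'d) \<Rightarrow> bool" where
  "compliance_tensor \<Omega> A \<longleftrightarrow>
     (\<forall>\<tau>. (\<lambda>x. A x \<tau>) \<in> borel_measurable (lebesgue_on \<Omega>)) \<and>
     (\<forall>x\<in>\<Omega>. linear (A x)) \<and>
     (\<forall>x\<in>\<Omega>. \<forall>\<sigma> \<tau>. A x \<sigma> \<bullet> \<tau> = \<sigma> \<bullet> A x \<tau>) \<and>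
     (\<forall>x\<in>\<Omega>. \<forall>\<tau>. transpose \<tau> = \<tau> \<longrightarrow> transpose (A x \<tau>) = A x \<tau>) \<and>
     (\<exists>B. AE x in lebesgue_on \<Omega>. \<forall>\<tau>. norm (A x \<tau>) \<le> B * norm \<tau>)"

definition compliance_bounds ::
  "(real^'d) set \<Rightarrow> (real^'d) set \<Rightarrow> (real^'d \<Rightarrow> real^'d^'d \<Rightarrow> real^'d^'d) \<Rightarrow> real \<Rightarrow> real \<Rightarrow> bool" where
  "compliance_bounds \<Omega> \<Gamma>N\<sigma> A a_min a_max \<longleftrightarrow> 0 < a_min \<and> a_min \<le> a_max \<and>
     (\<forall>\<tau>\<in>stress_space \<Omega> \<Gamma>N\<sigma>.
        a_min * (l2norm \<Omega> \<tau>)\<^sup>2 \<le> l2inner \<Omega> (\<lambda>x. A x (\<tau> x)) \<tau> \<and>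
        l2inner \<Omega> (\<lambda>x. A x (\<tau> x)) \<tau> \<le> a_max * (l2norm \<Omega> \<tau>)\<^sup>2)"

definition permeability_tensor :: "(real^'d) set \<Rightarrow> (real^'d \<Rightarrow> real^'d^'d) \<Rightarrow> bool" where
  "permeability_tensor \<Omega> K \<longleftrightarrow>
     K \<in> borel_measurable (lebesgue_on \<Omega>) \<and>
     (\<forall>x\<in>\<Omega>. transpose (K x) = K x) \<and>
     (\<exists>B. AE x in lebesgue_on \<Omega>. norm (K x) \<le> B)"

definition permeability_bounds ::
  "(real^'d) set \<Rightarrow> (real^'d) set \<Rightarrow> (real^'d \<Rightarrow> real^'d^'d) \<Rightarrow> real \<Rightarrow> real \<Rightarrow> bool" where
  "permeability_bounds \<Omega> \<Gamma>Nz K k_min k_max \<longleftrightarrow> 0 < k_min \<and> k_min \<le> k_max \<and>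
     (\<forall>q\<in>velocity_space \<Omega> \<Gamma>Nz.
        k_min * (l2norm \<Omega> q)\<^sup>2 \<le> l2inner \<Omega> (\<lambda>x. K x *v q x) q \<and>
        l2inner \<Omega> (\<lambda>x. K x *v q x) q \<le> k_max * (l2norm \<Omega> q)\<^sup>2)"

text \<open>The positive semidefinite symmetric square root is unique whenever it exists.\<close>

definition op_sqrt :: "('a::euclidean_space \<Rightarrow> 'a) \<Rightarrow> 'a \<Rightarrow> 'a" where
  "op_sqrt T = (SOME S. linear S \<and> (\<forall>x y. S x \<bullet> y = x \<bullet> S y) \<and> (\<forall>x. 0 \<le> S x \<bullet> x) \<and> S \<circ> S = T)"

section \<open>Meshes and finite element spaces\<close>

text \<open>Elements are arbitrary regular closed sets, so simplicial, quadrilateral and hexahedral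
  partitions are all covered; conformity of the partition is not required.\<close>

definition partition_of_size :: "'a::euclidean_space set \<Rightarrow> real \<Rightarrow> 'a set set \<Rightarrow> bool" where
  "partition_of_size \<Omega> h \<T> \<longleftrightarrow>
     finite \<T> \<and> \<T> \<noteq> {} \<and> \<Union>\<T> = closure \<Omega> \<and>
     (\<forall>E\<in>\<T>. compact E \<and> interior E \<noteq> {} \<and> E = closure (interior E)) \<and>
     pairwise (\<lambda>E F. interior E \<inter> interior F = {}) \<T> \<and>
     h = Max (diameter ` \<T>)"

definition shape_regular :: "real set \<Rightarrow> (real \<Rightarrow> 'a::euclidean_space set set) \<Rightarrow> bool" where
  "shape_regular H \<T> \<longleftrightarrow>
     (\<exists>\<rho>>0. \<forall>h\<in>H. \<forall>E\<in>\<T> h. \<exists>x. cball x (\<rho> * diameter E) \<subseteq> E)"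

definition quasi_uniform :: "real set \<Rightarrow> (real \<Rightarrow> 'a::euclidean_space set set) \<Rightarrow> bool" where
  "quasi_uniform H \<T> \<longleftrightarrow> (\<exists>\<kappa>>0. \<forall>h\<in>H. \<forall>E\<in>\<T> h. \<kappa> * h \<le> diameter E)"

text \<open>A finite element space is a finite-dimensional linear space of functions whose restriction to
  the interior of every element extends continuously to the element. Polynomial and mapped
  polynomial shape functions are special cases. The two conditions on members hold almost
  everywhere, so a space may consist of chosen representatives or be closed under modification
  on null sets.\<close>

definition fe_space ::
  "'a::euclidean_space set \<Rightarrow> 'a set set \<Rightarrow> ('a \<Rightarrow> 'b::euclidean_space) set \<Rightarrow> bool" where
  "fe_space \<Omega> \<T> S \<longleftrightarrow>
     (\<lambda>x. 0) \<in> S \<and>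
     (\<forall>f\<in>S. \<forall>g\<in>S. (\<lambda>x. f x + g x) \<in> S) \<and>
     (\<forall>c. \<forall>f\<in>S. (\<lambda>x. c *\<^sub>R f x) \<in> S) \<and>
     (\<exists>B. finite B \<and> B \<subseteq> S \<and>
        (\<forall>f\<in>S. \<exists>c. AE x in lebesgue_on \<Omega>. f x = (\<Sum>b\<in>B. c b *\<^sub>R b x))) \<and>
     (\<forall>f\<in>S. \<forall>E\<in>\<T>. \<exists>g. continuous_on E g \<and> (AE x in lebesgue_on (interior E). f x = g x))"

text \<open>In the inf-sup conditions, a nonzero element of \<open>H(div)\<close> is one of nonzero norm; the
  suprema are taken in the extended reals so that they always exist.\<close>

definition infsup_elasticity ::
  "(real^'d) set \<Rightarrow> real \<Rightarrow> (real^'d \<Rightarrow> real^'d^'d) set \<Rightarrow> (real^'d \<Rightarrow> real^'d) set \<Rightarrow>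
   (real^'d \<Rightarrow> real^'d^'d) set \<Rightarrow> bool" where
  "infsup_elasticity \<Omega> C Xh Vh Qh \<longleftrightarrow>
     (\<forall>v\<in>Vh. \<forall>\<xi>\<in>Qh. ereal (l2norm \<Omega> v + l2norm \<Omega> \<xi>) \<le>
        ereal C * (SUP \<tau>\<in>{\<tau>\<in>Xh. hdiv_norm_mat \<Omega> \<tau> \<noteq> 0}.
          ereal ((l2inner \<Omega> v (wdiv_mat \<Omega> \<tau>) + l2inner \<Omega> \<xi> \<tau>) / hdiv_norm_mat \<Omega> \<tau>)))"

definition infsup_darcy ::
  "(real^'d) set \<Rightarrow> real \<Rightarrow> (real^'d \<Rightarrow> real^'d) set \<Rightarrow> (real^'d \<Rightarrow> real) set \<Rightarrow> bool" where
  "infsup_darcy \<Omega> C Zh Wh \<longleftrightarrow>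
     (\<forall>w\<in>Wh. ereal (l2norm \<Omega> w) \<le>
        ereal C * (SUP q\<in>{q\<in>Zh. hdiv_norm \<Omega> q \<noteq> 0}.
          ereal (l2inner \<Omega> (wdiv \<Omega> q) w / hdiv_norm \<Omega> q)))"

section \<open>The fixed stress scheme\<close>

text \<open>The first four equations, at one time level.\<close>

definition stationary_equations ::
  "(real^'d) set \<Rightarrow> (real^'d \<Rightarrow> real^'d^'d) \<Rightarrow> (real^'d \<Rightarrow> real^'d^'d \<Rightarrow> real^'d^'d) \<Rightarrow> real \<Rightarrow>
   (real^'d \<Rightarrow> real^'d^'d) set \<Rightarrow> (real^'d \<Rightarrow> real^'d) set \<Rightarrow> (real^'d \<Rightarrow> real^'d^'d) set \<Rightarrow>
   (real^'d \<Rightarrow> real^'d) set \<Rightarrow>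
   (real^'d \<Rightarrow> real^'d^'d) \<Rightarrow> (real^'d \<Rightarrow> real^'d) \<Rightarrow> (real^'d \<Rightarrow> real^'d^'d) \<Rightarrow>
   (real^'d \<Rightarrow> real^'d) \<Rightarrow> (real^'d \<Rightarrow> real) \<Rightarrow> bool" where
  "stationary_equations \<Omega> K A \<alpha> Xh Vh Qh Zh \<sigma> u \<gamma> z p \<longleftrightarrow>
     (\<forall>q\<in>Zh. l2inner \<Omega> (\<lambda>x. matrix_inv (K x) *v z x) q - l2inner \<Omega> p (wdiv \<Omega> q) = 0) \<and>
     (\<forall>\<tau>\<in>Xh. l2inner \<Omega> (\<lambda>x. A x (\<sigma> x)) \<tau> + l2inner \<Omega> u (wdiv_mat \<Omega> \<tau>) + l2inner \<Omega> \<gamma> \<tau>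
              = - l2inner \<Omega> (\<lambda>x. A x ((\<alpha> * p x) *\<^sub>R mat 1)) \<tau>) \<and>
     (\<forall>v\<in>Vh. l2inner \<Omega> (wdiv_mat \<Omega> \<sigma>) v = 0) \<and>
     (\<forall>\<xi>\<in>Qh. l2inner \<Omega> \<sigma> \<xi> = 0)"

text \<open>The pressure equation of the step to \<open>z1, p1\<close>; \<open>p0\<close> and \<open>\<sigma>0\<close> belong to the previous time
  level, \<open>\<sigma>m\<close> to the one before that.\<close>

definition pressure_equation ::
  "(real^'d) set \<Rightarrow> (real^'d \<Rightarrow> real^'d^'d \<Rightarrow> real^'d^'d) \<Rightarrow> real \<Rightarrow> real \<Rightarrow> real \<Rightarrow>
   (real^'d \<Rightarrow> real) set \<Rightarrow> (real^'d \<Rightarrow> real^'d^'d) \<Rightarrow> (real^'d \<Rightarrow> real^'d^'d) \<Rightarrow>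
   (real^'d \<Rightarrow> real) \<Rightarrow> (real^'d \<Rightarrow> real^'d) \<Rightarrow> (real^'d \<Rightarrow> real) \<Rightarrow> bool" where
  "pressure_equation \<Omega> A \<alpha> c0 dt Wh \<sigma>m \<sigma>0 p0 z1 p1 \<longleftrightarrow>
     (\<forall>w\<in>Wh.
        c0 * l2inner \<Omega> (\<lambda>x. (p1 x - p0 x) / dt) w
        + \<alpha> * l2inner \<Omega> (\<lambda>x. A x ((\<alpha> * ((p1 x - p0 x) / dt)) *\<^sub>R mat 1)) (\<lambda>x. w x *\<^sub>R mat 1)
        + l2inner \<Omega> (wdiv \<Omega> z1) w
        = - \<alpha> * l2inner \<Omega> (\<lambda>x. A x ((1 / dt) *\<^sub>R (\<sigma>0 x - \<sigma>m x))) (\<lambda>x. w x *\<^sub>R mat 1))"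

text \<open>Time levels \<open>0, \<dots>, N\<close>. Level \<open>0\<close> of the first four equations determines the initial data from
  \<open>p 0\<close>, and \<open>\<sigma> 0\<close> also plays the role of the stress at level \<open>-1\<close>.\<close>

definition fixed_stress_solution ::
  "(real^'d) set \<Rightarrow> (real^'d \<Rightarrow> real^'d^'d) \<Rightarrow> (real^'d \<Rightarrow> real^'d^'d \<Rightarrow> real^'d^'d) \<Rightarrow>
   real \<Rightarrow> real \<Rightarrow> real \<Rightarrow> nat \<Rightarrow>
   (real^'d \<Rightarrow> real^'d^'d) set \<Rightarrow> (real^'d \<Rightarrow> real^'d) set \<Rightarrow> (real^'d \<Rightarrow> real^'d^'d) set \<Rightarrow>
   (real^'d \<Rightarrow> real^'d) set \<Rightarrow> (real^'d \<Rightarrow> real) set \<Rightarrow>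
   (nat \<Rightarrow> real^'d \<Rightarrow> real^'d^'d) \<Rightarrow> (nat \<Rightarrow> real^'d \<Rightarrow> real^'d) \<Rightarrow> (nat \<Rightarrow> real^'d \<Rightarrow> real^'d^'d) \<Rightarrow>
   (nat \<Rightarrow> real^'d \<Rightarrow> real^'d) \<Rightarrow> (nat \<Rightarrow> real^'d \<Rightarrow> real) \<Rightarrow> bool" where
  "fixed_stress_solution \<Omega> K A \<alpha> c0 dt N Xh Vh Qh Zh Wh \<sigma> u \<gamma> z p \<longleftrightarrow>
     (\<forall>n\<le>N. \<sigma> n \<in> Xh \<and> u n \<in> Vh \<and> \<gamma> n \<in> Qh \<and> z n \<in> Zh \<and> p n \<in> Wh \<and>
        stationary_equations \<Omega> K A \<alpha> Xh Vh Qh Zh (\<sigma> n) (u n) (\<gamma> n) (z n) (p n)) \<and>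
     (\<forall>n<N. pressure_equation \<Omega> A \<alpha> c0 dt Wh
        (if n = 0 then \<sigma> 0 else \<sigma> (n - 1)) (\<sigma> n) (p n) (z (n + 1)) (p (n + 1)))"

end

theory Submission
  imports Defs
begin

text \<open>The proof is an energy estimate. Let \<open>\<delta>\<close> denote the increment from one time level to the next, and
  let \<open>P = \<alpha> \<delta>p I\<close>. Testing the elasticity equation of one level with the stress of another makes
  displacement and rotation drop out, because every discrete stress is orthogonal to the rotations and its
  divergence to the displacements. The increments therefore satisfy
  \<open>(A \<delta>\<sigma>, \<delta>\<sigma>) = - (A P, \<delta>\<sigma>)\<close>, so that the stress increment of a step is bounded by its pressure increment, \<open>(A \<delta>\<sigma>, \<delta>\<sigma>) \<le> (A P, P)\<close>, with constant \<open>1\<close>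
  (\<open>stress_increment_le\<close>). Now test the pressure equation with \<open>\<delta>p\<close>. By the Darcy equations of
  both levels the divergence term is \<open>(K\<inverse> \<delta>z, z)\<close> with \<open>z\<close> at the new level, hence at least half the increment of
  \<open>(K\<inverse> z, z)\<close>. The lagged term is at most half of \<open>(A P, P)\<close> plus half of \<open>(A \<delta>\<sigma>, \<delta>\<sigma>)\<close> of the
  previous step. The first half is absorbed, and the half that remains on the left dominates
  \<open>(A \<delta>\<sigma>, \<delta>\<sigma>) / 2\<close> of the present step, which is what the next step needs
  (\<open>energy_step\<close>). The estimate telescopes (\<open>energy_estimate\<close>); the chain starts
  with a vanishing lagged increment, so that only the initial flux is left on the right.

  At a fixed time level the inf-sup conditions bound the pressure by the flux, and displacement and
  rotation by \<open>A (\<sigma> + \<alpha> p I)\<close>, which is again bounded by the pressure (\<open>stationary_bound\<close>). Of the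
  bounds of the coefficients, only \<open>k_min\<close>, \<open>k_max\<close> and \<open>a_max\<close> enter the constant; \<open>a_min\<close>
  serves only to make the form of \<open>A\<close> positive.

  The field \<open>\<alpha> p I\<close> is in general not in \<open>H(div)\<close>, and \<open>K\<inverse>\<close> and \<open>A\<^sup>1\<^sup>/\<^sup>2\<close> are formed pointwise,
  whereas the bounds of \<open>A\<close> and \<open>K\<close> are given as integral inequalities over the spaces \<open>X\<close> and
  \<open>Z\<close>. These are first turned into bounds at almost every point (\<open>AE_quadratic_form_bounds\<close>), by
  testing with products of a constant and a \<open>C\<^sup>1\<close> function supported in the domain. Such
  products have a weak divergence and vanishing normal trace by Green's formula
  (\<open>C1c_field_Hdiv\<close>), and the functions approximate the indicators of open sets
  (\<open>C1c_approximates_indicator_open\<close>).\<close>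

section \<open>Symmetric operators on a Euclidean space\<close>

text \<open>The parabola vanishes at \<open>0\<close>, so it can stay nonnegative only if its slope there is zero.\<close>

lemma affine_quadratic_nonneg_imp_zero:
  fixes c d :: real
  assumes "\<And>t. 0 \<le> 2 * t * c + t\<^sup>2 * d"
  shows "c = 0"
proof (rule ccontr)
  assume "c \<noteq> 0"
  \<comment> \<open>the summand \<open>1\<close> covers \<open>d = 0\<close>\<close>
  define t where "t = - c / (\<bar>d\<bar> + 1)"
  have "t * (\<bar>d\<bar> + 1) = - c" by (simp add: t_def)
  then have "t\<^sup>2 * (\<bar>d\<bar> + 1) = - (t * c)" by (metis mult.assoc mult_minus_right power2_eq_square)
  moreover have "t\<^sup>2 * d \<le> t\<^sup>2 * (\<bar>d\<bar> + 1)" by (intro mult_left_mono) auto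
  ultimately have "0 \<le> t * c" using assms[of t] by linarith
  moreover have "t * c = - c\<^sup>2 / (\<bar>d\<bar> + 1)" by (simp add: t_def power2_eq_square)
  moreover have "- c\<^sup>2 / (\<bar>d\<bar> + 1) < 0" using \<open>c \<noteq> 0\<close> by (intro divide_neg_pos) auto
  ultimately show False by linarith
qed

text \<open>A maximiser of the Rayleigh quotient over the unit sphere of the invariant subspace is an eigenvector.\<close>

lemma symmetric_eigenvector_exists:
  fixes T :: "'a::euclidean_space \<Rightarrow> 'a"
  assumes T: "linear T" and sym: "\<And>x y. T x \<bullet> y = x \<bullet> T y"
    and U: "subspace U" and inv: "T ` U \<subseteq> U" and ne: "U \<noteq> {0}"
  obtains v l where "v \<in> U" "norm v = 1" "T v = l *\<^sub>R v"
proof -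
  interpret T: bounded_linear T using T by (rule linear_conv_bounded_linear[THEN iffD1])
  let ?K = "U \<inter> sphere 0 1"
  obtain w where w: "w \<in> U" "w \<noteq> 0" using ne subspace_0[OF U] by auto
  have "w /\<^sub>R norm w \<in> ?K" using w U by (auto simp: subspace_scale)
  then have "?K \<noteq> {}" by blast
  moreover have "compact ?K" using closed_subspace[OF U] by (intro closed_Int_compact) auto
  moreover have "continuous_on ?K (\<lambda>x. T x \<bullet> x)"
    by (intro continuous_on_inner T.continuous_on continuous_on_id)
  ultimately have "\<exists>x\<in>?K. \<forall>y\<in>?K. T y \<bullet> y \<le> T x \<bullet> x"
    by (intro continuous_attains_sup)
  then obtain v where v: "v \<in> ?K" and max: "\<And>y. y \<in> ?K \<Longrightarrow> T y \<bullet> y \<le> T v \<bullet> v"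
    by blast
  define l where "l = T v \<bullet> v"
  have vv: "v \<bullet> v = 1" and vU: "v \<in> U" using v by (auto simp: norm_eq_1)
  \<comment> \<open>\<open>q\<close> is nonnegative on \<open>U\<close> and vanishes at the maximiser, so its derivative there vanishes as well\<close>
  define q where "q x = l * (x \<bullet> x) - T x \<bullet> x" for x
  have q0: "0 \<le> q x" if "x \<in> U" for x
  proof (cases "x = 0")
    case False
    then have "x /\<^sub>R norm x \<in> ?K" using that U by (auto simp: subspace_scale)
    from max[OF this] have "(T x \<bullet> x) / (norm x)\<^sup>2 \<le> l"
      by (simp add: T.scaleR l_def power2_eq_square field_simps)
    with False show ?thesis by (simp add: q_def field_simps power2_norm_eq_inner)
  qed (simp add: q_def T.zero)
  define w where "w = l *\<^sub>R v - T v"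
  have wU: "w \<in> U" using vU inv U by (auto simp: w_def subspace_diff subspace_scale)
  have "0 \<le> 2 * t * (w \<bullet> w) + t\<^sup>2 * q w" for t
  proof -
    have "v + t *\<^sub>R w \<in> U" using vU wU U by (simp add: subspace_add subspace_scale)
    from q0[OF this] have "0 \<le> q v + 2 * t * ((l *\<^sub>R v - T v) \<bullet> w) + t\<^sup>2 * q w"
      using sym[of w v] sym[of v w]
      by (simp add: q_def T.add T.scaleR inner_simps inner_commute power2_eq_square algebra_simps)
    then show ?thesis by (simp add: q_def l_def[symmetric] vv w_def[symmetric])
  qed
  then have "w \<bullet> w = 0" by (rule affine_quadratic_nonneg_imp_zero)
  then have "T v = l *\<^sub>R v" by (simp add: w_def)
  with vU v show thesis by (intro that) auto
qed

text \<open>The spectral theorem, by splitting off one eigenvector at a time: its orthogonal complement is again invariant.\<close>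

lemma symmetric_orthonormal_eigenbasis:
  fixes T :: "'a::euclidean_space \<Rightarrow> 'a"
  assumes T: "linear T" and sym: "\<And>x y. T x \<bullet> y = x \<bullet> T y"
    and "subspace U" "T ` U \<subseteq> U"
  shows "\<exists>B. finite B \<and> pairwise orthogonal B \<and> (\<forall>b\<in>B. norm b = 1 \<and> (\<exists>l. T b = l *\<^sub>R b)) \<and> span B = U"
  using assms(3,4)
proof (induction "dim U" arbitrary: U rule: less_induct)
  case less
  show ?case
  proof (cases "U = {0}")
    case True
    then show ?thesis by (intro exI[of _ "{}"]) auto
  next
    case False
    obtain v l where v: "v \<in> U" "norm v = 1" "T v = l *\<^sub>R v"
      using symmetric_eigenvector_exists[OF T sym less.prems False] by metis
    define W where "W = U \<inter> {x. v \<bullet> x = 0}"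
    have W: "subspace W" "T ` W \<subseteq> W"
    proof -
      show "subspace W" unfolding W_def
        by (intro real_vector.subspace_inter less.prems subspace_hyperplane)
      show "T ` W \<subseteq> W"
        using less.prems(2) v(3) by (auto simp: W_def sym[of v, symmetric])
    qed
    have "v \<notin> W" using v(2) by (auto simp: W_def norm_eq_1)
    then have "W \<subset> U" using v(1) unfolding W_def by blast
    then have "dim W < dim U"
      by (metis W(1) less.prems(1) dim_psubset span_eq_iff)
    from less.hyps[OF this W] obtain B where B: "finite B" "pairwise orthogonal B"
      "\<And>b. b \<in> B \<Longrightarrow> norm b = 1 \<and> (\<exists>l. T b = l *\<^sub>R b)" "span B = W" by metis
    have "B \<subseteq> W" using B(4) span_superset by blast
    have "span (insert v B) = U"
    proof
      show "span (insert v B) \<subseteq> U"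
        using \<open>B \<subseteq> W\<close> v(1) less.prems(1) by (intro span_minimal) (auto simp: W_def)
      show "U \<subseteq> span (insert v B)"
      proof
        fix x assume "x \<in> U"
        then have "x - (v \<bullet> x) *\<^sub>R v \<in> W"
          using v less.prems(1)
          by (auto simp: W_def inner_simps norm_eq_1 subspace_diff subspace_scale)
        then show "x \<in> span (insert v B)" using B(4) by (auto simp: span_insert)
      qed
    qed
    moreover have "pairwise orthogonal (insert v B)"
      using B(2) \<open>B \<subseteq> W\<close> by (auto simp: pairwise_insert orthogonal_def W_def inner_commute)
    ultimately show ?thesis
      using B(1,3) v by (intro exI[of _ "insert v B"]) auto
  qed
qed

text \<open>Take the square roots of the eigenvalues in an orthonormal eigenbasis.\<close>

lemma op_sqrt_exists:
  fixes T :: "'a::euclidean_space \<Rightarrow> 'a"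
  assumes T: "linear T" and sym: "\<And>x y. T x \<bullet> y = x \<bullet> T y" and psd: "\<And>x. 0 \<le> T x \<bullet> x"
  shows "\<exists>S. linear S \<and> (\<forall>x y. S x \<bullet> y = x \<bullet> S y) \<and> (\<forall>x. 0 \<le> S x \<bullet> x) \<and> S \<circ> S = T"
proof -
  obtain B where B: "finite B" "pairwise orthogonal B"
      "\<And>b. b \<in> B \<Longrightarrow> norm b = 1 \<and> (\<exists>l. T b = l *\<^sub>R b)" "span B = UNIV"
    using symmetric_orthonormal_eigenbasis[OF T sym, of UNIV] by auto
  define S where "S x = (\<Sum>b\<in>B. (sqrt (T b \<bullet> b) * (x \<bullet> b)) *\<^sub>R b)" for x
  have lin: "linear S"
    by (rule linearI)
      (auto simp: S_def inner_simps algebra_simps sum.distrib scaleR_sum_right)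
  have Sb: "S b = sqrt (T b \<bullet> b) *\<^sub>R b" if "b \<in> B" for b
  proof -
    have "S b = (\<Sum>c\<in>B. if c = b then sqrt (T b \<bullet> b) *\<^sub>R b else 0)"
      unfolding S_def
    proof (rule sum.cong[OF refl])
      fix c assume "c \<in> B"
      then show "(sqrt (T c \<bullet> c) * (b \<bullet> c)) *\<^sub>R c = (if c = b then sqrt (T b \<bullet> b) *\<^sub>R b else 0)"
        using B(2) B(3)[OF that] that by (auto simp: pairwise_def orthogonal_def norm_eq_1)
    qed
    then show ?thesis using that B(1) by simp
  qed
  have "S (S b) = T b" if "b \<in> B" for b
  proof -
    obtain l where l: "T b = l *\<^sub>R b" "norm b = 1" using B(3)[OF \<open>b \<in> B\<close>] by auto
    then have "T b \<bullet> b = l" by (simp add: norm_eq_1)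
    with psd[of b] have "0 \<le> l" by simp
    have Sb': "S b = sqrt l *\<^sub>R b" using Sb[OF that] \<open>T b \<bullet> b = l\<close> by simp
    then have "S (S b) = (sqrt l * sqrt l) *\<^sub>R b" by (metis linear_cmul[OF lin] scaleR_scaleR)
    then show ?thesis using \<open>0 \<le> l\<close> l(1) by simp
  qed
  then have eqB: "\<And>b. b \<in> B \<Longrightarrow> (S \<circ> S) b = T b" by simp
  have "S \<circ> S = T"
  proof
    show "(S \<circ> S) x = T x" for x
      by (rule linear_eq_on_span[OF linear_compose[OF lin lin] T eqB]) (use B(4) in auto)
  qed
  moreover have "S x \<bullet> y = x \<bullet> S y" for x y
    unfolding S_def inner_sum_left inner_sum_right
    by (rule sum.cong[OF refl]) (simp add: inner_commute[of y])
  moreover have "0 \<le> S x \<bullet> x" for x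
  proof -
    have "S x \<bullet> x = (\<Sum>b\<in>B. sqrt (T b \<bullet> b) * (x \<bullet> b)\<^sup>2)"
      unfolding S_def inner_sum_left
      by (rule sum.cong[OF refl]) (simp add: inner_commute[of _ x] power2_eq_square)
    then show ?thesis using psd by (simp add: sum_nonneg)
  qed
  ultimately show ?thesis using lin by blast
qed

lemma norm_op_sqrt:
  fixes T :: "'a::euclidean_space \<Rightarrow> 'a"
  assumes "linear T" "\<And>x y. T x \<bullet> y = x \<bullet> T y" "\<And>x. 0 \<le> T x \<bullet> x"
  shows "(norm (op_sqrt T x))\<^sup>2 = T x \<bullet> x"
proof -
  let ?P = "\<lambda>S. linear S \<and> (\<forall>x y. S x \<bullet> y = x \<bullet> S y) \<and> (\<forall>x. 0 \<le> S x \<bullet> x) \<and> S \<circ> S = T"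
  have "?P (op_sqrt T)"
    unfolding op_sqrt_def by (rule someI_ex[of ?P, OF op_sqrt_exists[OF assms]])
  then show ?thesis by (metis comp_apply power2_norm_eq_inner)
qed

text \<open>Expand the nonnegative value of the form at \<open>x - T x / a\<close>. This controls \<open>T x\<close>
  by the energy, and the constant involves only the upper bound of the form.\<close>

lemma norm_sq_le_quadratic_form:
  fixes T :: "'a::real_inner \<Rightarrow> 'a"
  assumes T: "linear T" and sym: "\<And>x y. T x \<bullet> y = x \<bullet> T y"
    and psd: "\<And>x. 0 \<le> T x \<bullet> x" and le: "\<And>x. T x \<bullet> x \<le> a * (norm x)\<^sup>2" and "0 < a"
  shows "(norm (T x))\<^sup>2 \<le> a * (T x \<bullet> x)"
proof -
  define y where "y = T x"
  define s where "s = 1 / a"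
  have sa: "s * a = 1" "0 < s" using \<open>0 < a\<close> by (auto simp: s_def)
  have "0 \<le> T (x - s *\<^sub>R y) \<bullet> (x - s *\<^sub>R y)" by (rule psd)
  also have "\<dots> = T x \<bullet> x - 2 * s * (y \<bullet> y) + s\<^sup>2 * (T y \<bullet> y)"
    using sym[of y x]
    by (simp add: linear_diff[OF T] linear_cmul[OF T] inner_simps y_def[symmetric] inner_commute
        power2_eq_square algebra_simps)
  also have "s\<^sup>2 * (T y \<bullet> y) \<le> s\<^sup>2 * (a * (y \<bullet> y))"
    using le[of y] by (intro mult_left_mono) (auto simp: power2_norm_eq_inner)
  also have "s\<^sup>2 * (a * (y \<bullet> y)) = s * (s * a) * (y \<bullet> y)" by (simp add: power2_eq_square)
  finally have "s * (y \<bullet> y) \<le> T x \<bullet> x" by (simp add: sa(1))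
  then have "a * (s * (y \<bullet> y)) \<le> a * (T x \<bullet> x)" using \<open>0 < a\<close> by (intro mult_left_mono) auto
  then show ?thesis using \<open>0 < a\<close> by (simp add: s_def y_def power2_norm_eq_inner)
qed

lemma pos_def_matrix_inv:
  fixes K :: "real^'d^'d"
  assumes sym: "transpose K = K"
    and lower: "\<And>v. k_min * (norm v)\<^sup>2 \<le> (K *v v) \<bullet> v"
    and upper: "\<And>v. (K *v v) \<bullet> v \<le> k_max * (norm v)\<^sup>2" and "0 < k_min" "0 < k_max"
  shows "det K \<noteq> 0" "K *v (matrix_inv K *v v) = v"
    "(matrix_inv K *v v) \<bullet> w = v \<bullet> (matrix_inv K *v w)"
    "(norm (matrix_inv K *v v))\<^sup>2 \<le> (1 / k_min) * ((matrix_inv K *v v) \<bullet> v)"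
    "(norm v)\<^sup>2 \<le> k_max * ((matrix_inv K *v v) \<bullet> v)"
proof -
  have symK: "(K *v x) \<bullet> y = x \<bullet> (K *v y)" for x y
    by (metis dot_lmul_matrix sym transpose_matrix_vector)
  have "x = 0" if "K *v x = 0" for x
  proof -
    have "k_min * (norm x)\<^sup>2 \<le> 0" using lower[of x] that by simp
    then show ?thesis using \<open>0 < k_min\<close> by (simp add: mult_le_0_iff)
  qed
  then have inv: "invertible K"
    using matrix_left_invertible_ker[of K] by (metis invertible_left_inverse)
  then show "det K \<noteq> 0" by (simp add: invertible_det_nz)
  have "K ** matrix_inv K = mat 1"
    using inv unfolding invertible_def matrix_inv_def by (rule someI2_ex) auto
  then show KK: "K *v (matrix_inv K *v v) = v" for v
    by (metis matrix_vector_mul_assoc matrix_vector_mul_lid)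
  show "(matrix_inv K *v v) \<bullet> w = v \<bullet> (matrix_inv K *v w)"
    by (metis KK symK)
  show "(norm (matrix_inv K *v v))\<^sup>2 \<le> (1 / k_min) * ((matrix_inv K *v v) \<bullet> v)"
    using lower[of "matrix_inv K *v v"] \<open>0 < k_min\<close> by (simp add: KK inner_commute field_simps)
  have "0 \<le> (K *v x) \<bullet> x" for x
    by (rule order_trans[OF _ lower]) (use \<open>0 < k_min\<close> in simp)
  from norm_sq_le_quadratic_form[OF matrix_vector_mul_linear symK this upper \<open>0 < k_max\<close>, of "matrix_inv K *v v"]
  show "(norm v)\<^sup>2 \<le> k_max * ((matrix_inv K *v v) \<bullet> v)" by (simp add: KK inner_commute)
qed

section \<open>Continuously differentiable functions of compact support\<close>

text \<open>Outside its support the function vanishes on a neighbourhood.\<close>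

lemma C1c_grad_eq_0:
  assumes "C1c_with_grad \<phi> g" "x \<notin> closure {x. \<phi> x \<noteq> 0}"
  shows "\<phi> x = 0" "g x = 0"
proof -
  show "\<phi> x = 0" using assms(2) closure_subset[of "{x. \<phi> x \<noteq> 0}"] by auto
  have "(\<phi> has_derivative (\<lambda>h. h \<bullet> g x)) (at x)"
    using assms(1) by (simp add: C1c_with_grad_def gderiv_def)
  moreover have "(\<phi> has_derivative (\<lambda>h. 0)) (at x)"
    by (rule has_derivative_transform_within_open[OF has_derivative_const, of "- closure {x. \<phi> x \<noteq> 0}" x 0])
      (use assms(2) closure_subset[of "{x. \<phi> x \<noteq> 0}"] in auto)
  ultimately have "(\<lambda>h. h \<bullet> g x) = (\<lambda>h. 0)" by (rule has_derivative_unique)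
  then have "g x \<bullet> g x = 0" by metis
  then show "g x = 0" by simp
qed

lemma C1c_continuous:
  assumes "C1c_with_grad \<phi> g"
  shows "continuous_on UNIV \<phi>" "continuous_on UNIV g"
proof -
  show "continuous_on UNIV \<phi>"
    using assms unfolding C1c_with_grad_def gderiv_def
    by (metis has_derivative_continuous_on has_derivative_at_withinI)
  show "continuous_on UNIV g" using assms by (simp add: C1c_with_grad_def)
qed

lemma C1c_bounded:
  assumes "C1c_with_grad \<phi> g"
  obtains M where "0 < M" "\<And>x. \<bar>\<phi> x\<bar> \<le> M" "\<And>x. norm (g x) \<le> M"
proof -
  let ?K = "closure {x. \<phi> x \<noteq> 0}"
  have K: "compact ?K" using assms by (simp add: C1c_with_grad_def)
  have "bounded (\<phi> ` ?K)" "bounded (g ` ?K)"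
    using K C1c_continuous[OF assms]
    by (meson compact_continuous_image compact_imp_bounded continuous_on_subset subset_UNIV)+
  then obtain a b where a: "0 < a" "\<And>x. x \<in> ?K \<Longrightarrow> norm (\<phi> x) \<le> a"
    and b: "0 < b" "\<And>x. x \<in> ?K \<Longrightarrow> norm (g x) \<le> b"
    unfolding bounded_pos by (metis imageI)
  show thesis
  proof
    show "0 < max a b" using a by simp
    show "\<bar>\<phi> x\<bar> \<le> max a b" for x
      using a(2)[of x] a(1) C1c_grad_eq_0[OF assms, of x] by (cases "x \<in> ?K") (auto simp: le_max_iff_disj)
    show "norm (g x) \<le> max a b" for x
      using b(2)[of x] a(1) C1c_grad_eq_0[OF assms, of x] by (cases "x \<in> ?K") (auto simp: le_max_iff_disj)
  qed
qed

lemma C1c_mult: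
  assumes "C1c_with_grad \<phi> g" "C1c_with_grad \<psi> k"
  shows "C1c_with_grad (\<lambda>x. \<phi> x * \<psi> x) (\<lambda>x. \<phi> x *\<^sub>R k x + \<psi> x *\<^sub>R g x)"
    "closure {x. \<phi> x * \<psi> x \<noteq> 0} \<subseteq> closure {x. \<phi> x \<noteq> 0}"
proof -
  show sub: "closure {x. \<phi> x * \<psi> x \<noteq> 0} \<subseteq> closure {x. \<phi> x \<noteq> 0}" by (intro closure_mono) auto
  have "compact (closure {x. \<phi> x * \<psi> x \<noteq> 0})"
    using assms(1) unfolding C1c_with_grad_def compact_closure
    by (auto intro: bounded_subset[of "{x. \<phi> x \<noteq> 0}"])
  then show "C1c_with_grad (\<lambda>x. \<phi> x * \<psi> x) (\<lambda>x. \<phi> x *\<^sub>R k x + \<psi> x *\<^sub>R g x)"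
    using assms C1c_continuous[OF assms(1)] C1c_continuous[OF assms(2)]
    unfolding C1c_with_grad_def by (auto intro!: GDERIV_mult continuous_intros)
qed

text \<open>The difference quotient is off by at most \<open>\<bar>h\<bar>\<close>, also across the kink of the positive part.\<close>

lemma DERIV_pos_part_squared:
  "DERIV (\<lambda>t::real. (max 0 t)\<^sup>2) t :> 2 * max 0 t"
  unfolding DERIV_def
proof (rule Lim_null[THEN iffD2], rule Lim_null_comparison)
  have "\<bar>(max 0 (t + h))\<^sup>2 - (max 0 t)\<^sup>2 - 2 * max 0 t * h\<bar> \<le> h\<^sup>2" for h
  proof -
    consider "0 \<le> t" "0 \<le> t + h" | "0 \<le> t" "t + h < 0" | "t < 0" "0 \<le> t + h" | "t < 0" "t + h < 0" by linarith
    then show ?thesis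
    proof cases
      case 2
      have "(t + h)\<^sup>2 \<le> h\<^sup>2" using 2 by (intro abs_le_square_iff[THEN iffD1]) auto
      moreover have "(max 0 (t + h))\<^sup>2 - (max 0 t)\<^sup>2 - 2 * max 0 t * h = h\<^sup>2 - (t + h)\<^sup>2"
        using 2 by (simp add: power2_eq_square algebra_simps)
      ultimately show ?thesis by simp
    next
      case 3
      have "(t + h)\<^sup>2 \<le> h\<^sup>2" using 3 by (intro abs_le_square_iff[THEN iffD1]) auto
      then show ?thesis using 3 by simp
    qed (auto simp: power2_eq_square algebra_simps)
  qed note bd = this
  show "\<forall>\<^sub>F h in at 0. norm (((max 0 (t + h))\<^sup>2 - (max 0 t)\<^sup>2) / h - 2 * max 0 t) \<le> \<bar>h\<bar>"
  proof (rule eventually_at_filter[THEN iffD2], intro always_eventually allI impI)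
    fix h :: real assume "h \<noteq> 0"
    then have "((max 0 (t + h))\<^sup>2 - (max 0 t)\<^sup>2) / h - 2 * max 0 t =
      ((max 0 (t + h))\<^sup>2 - (max 0 t)\<^sup>2 - 2 * max 0 t * h) / h"
      by (simp add: field_simps)
    moreover have "\<bar>(max 0 (t + h))\<^sup>2 - (max 0 t)\<^sup>2 - 2 * max 0 t * h\<bar> / \<bar>h\<bar> \<le> h\<^sup>2 / \<bar>h\<bar>"
      by (rule divide_right_mono[OF bd]) simp
    moreover have "h\<^sup>2 / \<bar>h\<bar> = \<bar>h\<bar>" using \<open>h \<noteq> 0\<close> by (simp add: power2_eq_square abs_if)
    ultimately show "norm (((max 0 (t + h))\<^sup>2 - (max 0 t)\<^sup>2) / h - 2 * max 0 t) \<le> \<bar>h\<bar>"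
      by simp
  qed
  show "((\<lambda>h::real. \<bar>h\<bar>) \<longlongrightarrow> 0) (at 0)" by (rule tendsto_rabs_zero[OF tendsto_ident_at])
qed

text \<open>The square makes the positive part of \<open>r\<^sup>2 - \<parallel>x - c\<parallel>\<^sup>2\<close> continuously differentiable across the sphere.\<close>

lemma C1c_ball_bump:
  fixes c :: "'a::euclidean_space"
  assumes "0 \<le> r"
  obtains g where "C1c_with_grad (\<lambda>x. (max 0 (r\<^sup>2 - (norm (x - c))\<^sup>2))\<^sup>2) g"
    "{x. (max 0 (r\<^sup>2 - (norm (x - c))\<^sup>2))\<^sup>2 \<noteq> 0} = ball c r"
proof
  let ?h = "\<lambda>x. (max 0 (r\<^sup>2 - (norm (x - c))\<^sup>2))\<^sup>2"
  let ?g = "\<lambda>x. (2 * max 0 (r\<^sup>2 - (norm (x - c))\<^sup>2)) *\<^sub>R (- 2 *\<^sub>R (x - c))"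
  show supp: "{x. ?h x \<noteq> 0} = ball c r"
    using assms by (auto simp: dist_norm norm_minus_commute max_def power2_less_imp_less not_le
        intro: power_strict_mono)
  have q: "GDERIV (\<lambda>x. r\<^sup>2 - (norm (x - c))\<^sup>2) x :> - 2 *\<^sub>R (x - c)" for x
    unfolding gderiv_def power2_norm_eq_inner
    by (auto intro!: derivative_eq_intros simp: inner_simps inner_commute algebra_simps)
  have "GDERIV ?h x :> ?g x" for x
    by (rule GDERIV_DERIV_compose[OF q DERIV_pos_part_squared])
  moreover have "continuous_on UNIV ?g" by (intro continuous_intros)
  moreover have "compact (closure {x. ?h x \<noteq> 0})"
    unfolding supp by (rule compact_closure[THEN iffD2]) (rule bounded_ball)
  ultimately show "C1c_with_grad ?h ?g" by (simp add: C1c_with_grad_def)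
qed

lemma C1c_sum:
  fixes h :: "'i \<Rightarrow> 'a::euclidean_space \<Rightarrow> real"
  assumes "finite I" "\<And>i. i \<in> I \<Longrightarrow> C1c_with_grad (h i) (g i)"
  shows "C1c_with_grad (\<lambda>x. \<Sum>i\<in>I. h i x) (\<lambda>x. \<Sum>i\<in>I. g i x)"
    "closure {x. (\<Sum>i\<in>I. h i x) \<noteq> 0} \<subseteq> (\<Union>i\<in>I. closure {x. h i x \<noteq> 0})"
proof -
  have closed: "compact (\<Union>i\<in>I. closure {x. h i x \<noteq> 0})"
    using assms by (intro compact_UN) (auto simp: C1c_with_grad_def)
  have "{x. (\<Sum>i\<in>I. h i x) \<noteq> 0} \<subseteq> (\<Union>i\<in>I. {x. h i x \<noteq> 0})"
    by (auto intro: ccontr dest: sum.not_neutral_contains_not_neutral)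
  also have "\<dots> \<subseteq> (\<Union>i\<in>I. closure {x. h i x \<noteq> 0})" using closure_subset by fast
  finally show sub: "closure {x. (\<Sum>i\<in>I. h i x) \<noteq> 0} \<subseteq> (\<Union>i\<in>I. closure {x. h i x \<noteq> 0})"
    using closed compact_imp_closed closure_minimal by blast
  have "compact (closure {x. (\<Sum>i\<in>I. h i x) \<noteq> 0})"
    unfolding compact_closure
    by (rule bounded_subset[OF compact_imp_bounded[OF closed] order_trans[OF closure_subset sub]])
  moreover have "GDERIV (\<lambda>x. \<Sum>i\<in>I. h i x) x :> (\<Sum>i\<in>I. g i x)" for x
    using assms unfolding gderiv_def C1c_with_grad_def inner_sum_right
    by (intro has_derivative_sum) auto
  moreover have "continuous_on UNIV (\<lambda>x. \<Sum>i\<in>I. g i x)"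
    using assms by (intro continuous_on_sum) (auto simp: C1c_with_grad_def)
  ultimately show "C1c_with_grad (\<lambda>x. \<Sum>i\<in>I. h i x) (\<lambda>x. \<Sum>i\<in>I. g i x)"
    by (simp add: C1c_with_grad_def)
qed

text \<open>The map \<open>t \<mapsto> m t / (1 + m t)\<close> keeps the zeros and, for large \<open>m\<close>, pushes every positive value towards \<open>1\<close>.\<close>

lemma C1c_saturate:
  assumes h: "C1c_with_grad h g" "\<And>x. 0 \<le> h x" and "0 \<le> (m::real)"
  shows "C1c_with_grad (\<lambda>x. m * h x / (1 + m * h x)) (\<lambda>x. (m / (1 + m * h x)\<^sup>2) *\<^sub>R g x)"
    "closure {x. m * h x / (1 + m * h x) \<noteq> 0} \<subseteq> closure {x. h x \<noteq> 0}"
proof -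
  have pos: "0 < 1 + m * h x" for x using assms by (simp add: add_pos_nonneg)
  show sub: "closure {x. m * h x / (1 + m * h x) \<noteq> 0} \<subseteq> closure {x. h x \<noteq> 0}" by (intro closure_mono) auto
  have "compact (closure {x. m * h x / (1 + m * h x) \<noteq> 0})"
    using h(1) unfolding C1c_with_grad_def compact_closure
    by (auto intro: bounded_subset[of "{x. h x \<noteq> 0}"])
  moreover have "GDERIV (\<lambda>x. m * h x / (1 + m * h x)) x :> (m / (1 + m * h x)\<^sup>2) *\<^sub>R g x" for x
  proof (rule GDERIV_DERIV_compose[where g="\<lambda>t. m * t / (1 + m * t)"])
    show "GDERIV h x :> g x" using h(1) by (simp add: C1c_with_grad_def)
    show "DERIV (\<lambda>t. m * t / (1 + m * t)) (h x) :> m / (1 + m * h x)\<^sup>2"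
      using pos[of x] by (auto intro!: derivative_eq_intros simp: power2_eq_square field_simps)
  qed
  moreover have "continuous_on UNIV (\<lambda>x. (m / (1 + m * h x)\<^sup>2) *\<^sub>R g x)"
    using C1c_continuous[OF h(1)] pos by (intro continuous_intros) (auto simp: less_imp_neq[symmetric])
  ultimately show "C1c_with_grad (\<lambda>x. m * h x / (1 + m * h x)) (\<lambda>x. (m / (1 + m * h x)\<^sup>2) *\<^sub>R g x)"
    by (simp add: C1c_with_grad_def)
qed

text \<open>An open set is a countable union of balls whose closures it contains. The sum of the bumps of the first
  \<open>m\<close> balls is eventually bounded below at each point of the set, so that saturating it with factor \<open>m\<close>
  tends to \<open>1\<close> there.\<close>

lemma C1c_approximates_indicator_open:
  fixes U :: "'a::euclidean_space set"
  assumes "open U"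
  obtains \<phi> :: "nat \<Rightarrow> 'a \<Rightarrow> real" and g where
    "\<And>m. C1c_with_grad (\<phi> m) (g m)" "\<And>m. closure {x. \<phi> m x \<noteq> 0} \<subseteq> U"
    "\<And>m x. 0 \<le> \<phi> m x" "\<And>m x. \<phi> m x \<le> 1" "\<And>x. (\<lambda>m. \<phi> m x) \<longlonglongrightarrow> indicator U x"
proof -
  define h where "h = (\<lambda>(c::'a, r) x. (max 0 (r\<^sup>2 - (norm (x - c))\<^sup>2))\<^sup>2)"
  define P where "P = {(c, r). 0 < r \<and> cball c r \<subseteq> U}"
  have union: "(\<Union>(c, r)\<in>P. ball c r) = U"
  proof (intro equalityI subsetI)
    fix x assume "x \<in> U"
    then obtain r where "0 < r" "cball x r \<subseteq> U" using assms open_contains_cball by blast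
    then show "x \<in> (\<Union>(c, r)\<in>P. ball c r)" by (intro UN_I[of "(x, r)"]) (auto simp: P_def)
  qed (force simp: P_def)
  obtain F where F: "F \<subseteq> (\<lambda>(c, r). ball c r) ` P" "countable F" "\<Union>F = U"
    using Lindelof[of "(\<lambda>(c, r). ball c r) ` P"] union by (metis (no_types, lifting) case_prod_beta image_iff open_ball)
  obtain Q where Q: "Q \<subseteq> P" "countable Q" "F = (\<lambda>(c, r). ball c r) ` Q"
    using F(1,2) by (metis countable_image_eq_inj countable_subset_image)
  show thesis
  proof (cases "Q = {}")
    case True
    then have "U = {}" using F(3) Q(3) by auto
    then show thesis
      by (intro that[of "\<lambda>m x. 0" "\<lambda>m x. 0"]) (auto simp: C1c_with_grad_def GDERIV_const)
  next
    case False
    define e where "e = from_nat_into Q"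
    have e: "e i \<in> P" for i using from_nat_into[OF False] Q(1) by (auto simp: e_def)
    have "\<exists>g. C1c_with_grad (h (e i)) g \<and> {x. h (e i) x \<noteq> 0} = ball (fst (e i)) (snd (e i))" for i
    proof -
      have "0 \<le> snd (e i)" using e[of i] by (auto simp: P_def)
      then obtain g where "C1c_with_grad (h (e i)) g" "{x. h (e i) x \<noteq> 0} = ball (fst (e i)) (snd (e i))"
        unfolding h_def split_beta by (rule C1c_ball_bump)
      then show ?thesis by blast
    qed
    then obtain g where g: "\<And>i. C1c_with_grad (h (e i)) (g i)"
      and supp: "\<And>i. {x. h (e i) x \<noteq> 0} = ball (fst (e i)) (snd (e i))" by metis
    have h0: "0 \<le> h p x" for p x by (simp add: h_def split_beta)
    define s where "s m x = (\<Sum>i<m. h (e i) x)" for m x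
    have s0: "0 \<le> s m x" for m x unfolding s_def by (intro sum_nonneg h0)
    have sC: "C1c_with_grad (s m) (\<lambda>x. \<Sum>i<m. g i x)"
      and sS: "closure {x. s m x \<noteq> 0} \<subseteq> (\<Union>i<m. closure {x. h (e i) x \<noteq> 0})" for m
      unfolding s_def[abs_def] using C1c_sum[of "{..<m}" "\<lambda>i. h (e i)" g] g by auto
    have clU: "closure {x. h (e i) x \<noteq> 0} \<subseteq> U" for i
      using e[of i] closure_mono[OF ball_subset_cball] by (fastforce simp: supp P_def)
    define \<phi> where "\<phi> m x = real m * s m x / (1 + real m * s m x)" for m x
    show thesis
    proof (rule that)
      show "C1c_with_grad (\<phi> m) (\<lambda>x. (real m / (1 + real m * s m x)\<^sup>2) *\<^sub>R (\<Sum>i<m. g i x))" for m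
        unfolding \<phi>_def[abs_def] by (rule C1c_saturate[OF sC s0 of_nat_0_le_iff])
      show "closure {x. \<phi> m x \<noteq> 0} \<subseteq> U" for m
        using C1c_saturate(2)[OF sC s0 of_nat_0_le_iff, of m m] sS[of m] clU unfolding \<phi>_def by blast
      have pos: "0 < 1 + real m * s m x" for m x using s0[of m x] by (simp add: add_pos_nonneg)
      show "0 \<le> \<phi> m x" for m x using s0[of m x] pos[of m x] by (simp add: \<phi>_def)
      show "\<phi> m x \<le> 1" for m x using pos[of m x] by (simp add: \<phi>_def field_simps)
      show "(\<lambda>m. \<phi> m x) \<longlonglongrightarrow> indicator U x" for x
      proof (cases "x \<in> U")
        case False
        then have "x \<notin> closure {x. \<phi> m x \<noteq> 0}" for m
          using C1c_saturate(2)[OF sC s0 of_nat_0_le_iff, of m m] sS[of m] clU unfolding \<phi>_def by blast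
        then have "\<phi> m x = 0" for m using closure_subset[of "{x. \<phi> m x \<noteq> 0}"] by blast
        then show ?thesis using False by simp
      next
        case True
        then obtain p where "p \<in> Q" "x \<in> ball (fst p) (snd p)"
          using F(3) Q(3) by (auto simp: split_beta)
        then obtain j where j: "x \<in> ball (fst (e j)) (snd (e j))"
          using from_nat_into_surj[OF Q(2)] unfolding e_def by blast
        define d where "d = h (e j) x"
        have "d \<noteq> 0" using j supp[of j] unfolding d_def by blast
        then have d: "0 < d" using h0[of "e j" x] by (simp add: d_def)
        have ge: "d \<le> s m x" if "j < m" for m
          unfolding s_def d_def by (rule member_le_sum) (use that h0 in auto)
        have "(\<lambda>m. 1 - \<phi> m x) \<longlonglongrightarrow> 0"
        proof (rule tendsto_sandwich[OF _ _ tendsto_const])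
          show "\<forall>\<^sub>F m in sequentially. 0 \<le> 1 - \<phi> m x"
            using \<open>\<And>m x. \<phi> m x \<le> 1\<close> by simp
          show "\<forall>\<^sub>F m in sequentially. 1 - \<phi> m x \<le> inverse d * inverse (real m)"
            using eventually_gt_at_top[of j]
          proof eventually_elim
            case (elim m)
            have "1 - \<phi> m x = 1 / (1 + real m * s m x)" using pos[of m x] by (simp add: \<phi>_def field_simps)
            also have "\<dots> \<le> 1 / (real m * d)"
            proof (rule divide_left_mono)
              show "real m * d \<le> 1 + real m * s m x"
                using mult_left_mono[OF ge[OF elim], of "real m"] by linarith
              show "0 < (1 + real m * s m x) * (real m * d)" using pos[of m x] d elim by auto
            qed simp
            finally show ?case by (simp add: field_simps)
          qed
          show "(\<lambda>m. inverse d * inverse (real m)) \<longlonglongrightarrow> 0"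
            by (rule tendsto_mult_right_zero[OF lim_inverse_n])
        qed
        then have "(\<lambda>m. 1 - (1 - \<phi> m x)) \<longlonglongrightarrow> 1 - 0" by (intro tendsto_diff tendsto_const)
        then show ?thesis using True by simp
      qed
    qed
  qed
qed

section \<open>Localisation and integration by parts\<close>

text \<open>Dominated convergence extends the test inequality to indicators of open sets, and then, through countable
  intersections of open sets, to the set where \<open>f\<close> is negative, which is such an intersection up to a
  null set. The test functions enter squared because a quadratic form tested with \<open>\<phi> v\<close> produces
  \<open>\<phi>\<^sup>2\<close>.\<close>

lemma AE_nonneg_of_C1c_tests:
  fixes \<Omega> :: "'a::euclidean_space set" and f :: "'a \<Rightarrow> real"
  assumes "open \<Omega>" and f: "integrable (lebesgue_on \<Omega>) f"
    and test: "\<And>\<phi> g. C1c_with_grad \<phi> g \<Longrightarrow> closure {x. \<phi> x \<noteq> 0} \<subseteq> \<Omega> \<Longrightarrow>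
      0 \<le> (LINT x|lebesgue_on \<Omega>. (\<phi> x)\<^sup>2 * f x)"
  shows "AE x in lebesgue_on \<Omega>. 0 \<le> f x"
proof -
  have \<Omega>: "\<Omega> \<in> sets lebesgue" using \<open>open \<Omega>\<close> by auto
  have [measurable]: "f \<in> borel_measurable (lebesgue_on \<Omega>)" using f by auto
  have nf: "integrable (lebesgue_on \<Omega>) (\<lambda>x. \<bar>f x\<bar>)" using f by simp
  have indm: "(indicator U :: 'a \<Rightarrow> real) \<in> borel_measurable (lebesgue_on \<Omega>)" if "U \<in> sets lebesgue" for U :: "'a set"
    by (rule measurable_restrict_space1) (use that in simp)
  have open_case: "0 \<le> (LINT x|lebesgue_on \<Omega>. indicator U x * f x)" if "open U" "U \<subseteq> \<Omega>" for U
  proof -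
    obtain \<phi> g where C: "\<And>m::nat. C1c_with_grad (\<phi> m) (g m)" "\<And>m. closure {x. \<phi> m x \<noteq> 0} \<subseteq> U"
      and bd: "\<And>m x. 0 \<le> \<phi> m x" "\<And>m x. \<phi> m x \<le> 1"
      and lim: "\<And>x. (\<lambda>m. \<phi> m x) \<longlonglongrightarrow> indicator U x"
      using C1c_approximates_indicator_open[OF \<open>open U\<close>] by metis
    have [measurable]: "\<phi> m \<in> borel_measurable (lebesgue_on \<Omega>)" for m
      by (rule continuous_imp_measurable_on_sets_lebesgue[OF continuous_on_subset[OF C1c_continuous(1)[OF C(1)]] \<Omega>]) auto
    have "(\<lambda>m. LINT x|lebesgue_on \<Omega>. (\<phi> m x)\<^sup>2 * f x) \<longlonglongrightarrow> (LINT x|lebesgue_on \<Omega>. indicator U x * f x)"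
    proof (rule integral_dominated_convergence[where w="\<lambda>x. \<bar>f x\<bar>"])
      show "(\<lambda>x. indicator U x * f x) \<in> borel_measurable (lebesgue_on \<Omega>)"
        using indm[of U] that by auto
      show "AE x in lebesgue_on \<Omega>. (\<lambda>m. (\<phi> m x)\<^sup>2 * f x) \<longlonglongrightarrow> indicator U x * f x"
      proof (intro always_eventually allI tendsto_mult tendsto_const)
        fix x
        show "(\<lambda>m. (\<phi> m x)\<^sup>2) \<longlonglongrightarrow> indicator U x"
          using tendsto_power[OF lim[of x], of 2] by (cases "x \<in> U") auto
      qed
      show "AE x in lebesgue_on \<Omega>. norm ((\<phi> m x)\<^sup>2 * f x) \<le> \<bar>f x\<bar>" for m
        using bd by (auto intro!: always_eventually mult_left_le_one_le simp: abs_mult power_le_one)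
    qed (use nf in auto)
    then show ?thesis
      by (rule LIMSEQ_le_const) (use test[OF C(1)] C(2) that in blast)
  qed
  define E where "E = {x \<in> \<Omega>. f x < 0}"
  have E: "E \<in> sets lebesgue"
  proof -
    have "{x \<in> space (lebesgue_on \<Omega>). f x < 0} \<in> sets (lebesgue_on \<Omega>)" by measurable
    then show ?thesis using \<Omega> by (simp add: E_def sets_restrict_space_iff)
  qed
  obtain C T where CT: "gdelta C" "T \<in> null_sets lebesgue" "E \<union> T = C" "disjnt E T"
    using lebesgue_set_almost_gdelta[OF E] by metis
  from CT(1) obtain F where F: "\<And>n::nat. open (F n)" "C = (\<Inter>n. F n)" by (auto elim: gdelta.cases)
  \<comment> \<open>finite intersections decrease to the countable one and stay inside the domain\<close>
  define G where "G n = (\<Inter>i\<le>n. F i) \<inter> \<Omega>" for n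
  have G: "open (G n)" "G n \<subseteq> \<Omega>" for n
    using F(1) \<open>open \<Omega>\<close> by (auto simp: G_def intro!: open_Int open_INT)
  have "(\<lambda>n. LINT x|lebesgue_on \<Omega>. indicator (G n) x * f x) \<longlonglongrightarrow> (LINT x|lebesgue_on \<Omega>. indicator E x * f x)"
  proof (rule integral_dominated_convergence[where w="\<lambda>x. \<bar>f x\<bar>"])
    show "(\<lambda>x. indicator E x * f x) \<in> borel_measurable (lebesgue_on \<Omega>)"
      using indm[OF E] by auto
    show "(\<lambda>x. indicator (G n) x * f x) \<in> borel_measurable (lebesgue_on \<Omega>)" for n
      using indm[of "G n"] G(1) by auto
    have dec: "decseq G" by (force simp: decseq_def G_def)
    have "AE x in lebesgue. x \<notin> T" by (rule AE_not_in[OF CT(2)])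
    then have "AE x in lebesgue_on \<Omega>. x \<notin> T" using \<Omega> by (auto simp: AE_restrict_space_iff)
    then show "AE x in lebesgue_on \<Omega>. (\<lambda>n. indicator (G n) x * f x) \<longlonglongrightarrow> indicator E x * f x"
    proof (rule lebesgue_on_mono)
      fix x assume "x \<notin> T" "x \<in> \<Omega>"
      have "(\<Inter>n. G n) = C \<inter> \<Omega>" unfolding G_def F(2) by blast
      then have "(indicator (\<Inter>n. G n) x :: real) = indicator E x"
        using CT(3) \<open>x \<notin> T\<close> \<open>x \<in> \<Omega>\<close> unfolding indicator_def by auto
      then show "(\<lambda>n. indicator (G n) x * f x) \<longlonglongrightarrow> indicator E x * f x"
        using LIMSEQ_indicator_decseq[OF dec, of x, where 'a=real] by (intro tendsto_mult tendsto_const) simp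
    qed
    show "AE x in lebesgue_on \<Omega>. norm (indicator (G n) x * f x) \<le> \<bar>f x\<bar>" for n
      by (auto simp: indicator_def)
  qed (use nf in auto)
  then have ge: "0 \<le> (LINT x|lebesgue_on \<Omega>. indicator E x * f x)"
    by (rule LIMSEQ_le_const) (use open_case[OF G] in blast)
  have int: "integrable (lebesgue_on \<Omega>) (\<lambda>x. - (indicator E x * f x))"
  proof (rule Bochner_Integration.integrable_bound[OF nf])
    show "(\<lambda>x. - (indicator E x * f x)) \<in> borel_measurable (lebesgue_on \<Omega>)"
      using indm[OF E] by simp
  qed (auto simp: indicator_def)
  have nn: "AE x in lebesgue_on \<Omega>. 0 \<le> - (indicator E x * f x)"
    by (auto simp: E_def indicator_def)
  have "(LINT x|lebesgue_on \<Omega>. - (indicator E x * f x)) = 0"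
    using ge Bochner_Integration.integral_nonneg_AE[OF nn] by simp
  then have "AE x in lebesgue_on \<Omega>. - (indicator E x * f x) = 0"
    using integral_nonneg_eq_0_iff_AE[OF int nn] by simp
  then show ?thesis by (rule lebesgue_on_mono) (auto simp: E_def indicator_def split: if_splits)
qed

lemma integrable_continuous_compact_support:
  fixes F :: "'a::euclidean_space \<Rightarrow> 'b::euclidean_space"
  assumes "continuous_on UNIV F" "compact K" "\<And>x. x \<notin> K \<Longrightarrow> F x = 0"
  shows "integrable lborel F"
proof -
  have "integrable lborel (\<lambda>x. indicator K x *\<^sub>R F x)"
    by (rule borel_integrable_compact) (use assms continuous_on_subset[OF assms(1)] in auto)
  moreover have "(\<lambda>x. indicator K x *\<^sub>R F x) = F" using assms(3) by (auto simp: indicator_def)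
  ultimately show ?thesis by simp
qed

text \<open>By translation invariance the difference quotients have integral zero; they are uniformly bounded and
  supported in a fixed ball, so the limit may be taken under the integral.\<close>

lemma integral_directional_derivative_C1c:
  fixes \<phi> :: "'a::euclidean_space \<Rightarrow> real"
  assumes C: "C1c_with_grad \<phi> g"
  shows "(LINT x|lebesgue. g x \<bullet> v) = 0"
proof -
  let ?K = "closure {x. \<phi> x \<noteq> 0}"
  have K: "compact ?K" using C by (simp add: C1c_with_grad_def)
  have [measurable]: "\<phi> \<in> borel_measurable borel" "g \<in> borel_measurable borel"
    using C1c_continuous[OF C] by (auto intro: borel_measurable_continuous_onI)
  obtain M where M: "0 < M" "\<And>x. norm (g x) \<le> M" using C1c_bounded[OF C] by metis
  obtain R where R: "\<And>x. x \<in> ?K \<Longrightarrow> norm x \<le> R" using compact_imp_bounded[OF K] by (auto simp: bounded_iff)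
  have lip: "\<bar>\<phi> y - \<phi> x\<bar> \<le> M * norm (y - x)" for x y
  proof -
    have "norm (\<phi> y - \<phi> x) \<le> M * norm (y - x)"
    proof (rule differentiable_bound[OF convex_UNIV])
      show "(\<phi> has_derivative (\<lambda>h. h \<bullet> g x)) (at x within UNIV)" for x
        using C by (simp add: C1c_with_grad_def gderiv_def)
      show "onorm (\<lambda>h. h \<bullet> g x) \<le> M" for x
      proof (rule onorm_bound)
        show "norm (h \<bullet> g x) \<le> M * norm h" for h
          using Cauchy_Schwarz_ineq2[of h "g x"] mult_left_mono[OF M(2)[of x] norm_ge_zero[of h]]
          by (simp add: mult.commute)
      qed (use M in simp)
    qed auto
    then show ?thesis by simp
  qed
  define t where "t n = inverse (real (Suc n))" for n
  have t: "0 < t n" "t n \<le> 1" for n by (auto simp: t_def field_simps)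
  have t0: "t \<longlonglongrightarrow> 0" unfolding t_def by (rule LIMSEQ_inverse_real_of_nat)
  define D where "D n x = (\<phi> (t n *\<^sub>R v + x) - \<phi> x) / t n" for n x
  have int\<phi>: "integrable lborel \<phi>"
    by (rule integrable_continuous_compact_support[OF C1c_continuous(1)[OF C] K]) (rule C1c_grad_eq_0[OF C])
  have int_shift: "integrable lborel (\<lambda>x. \<phi> (c + x))" "(LINT x|lborel. \<phi> (c + x)) = (LINT x|lborel. \<phi> x)" for c
    using integrable_distr_eq[of "(+) c" lborel borel \<phi>] integral_distr[of "(+) c" lborel borel \<phi>] int\<phi>
    by (simp_all add: lborel_distr_plus)
  have D_int: "(LINT x|lborel. D n x) = 0" for n
    unfolding D_def using int_shift[of "t n *\<^sub>R v"] int\<phi> by simp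
  have "(\<lambda>n. LINT x|lborel. D n x) \<longlonglongrightarrow> (LINT x|lborel. g x \<bullet> v)"
  proof (rule integral_dominated_convergence[where w="\<lambda>x. indicator (cball 0 (R + norm v)) x *\<^sub>R (M * norm v)"])
    show "(\<lambda>x. g x \<bullet> v) \<in> borel_measurable lborel" by simp
    show "D n \<in> borel_measurable lborel" for n unfolding D_def by measurable
    show "integrable lborel (\<lambda>x. indicator (cball 0 (R + norm v)) x *\<^sub>R (M * norm v))"
      using emeasure_bounded_finite[OF bounded_cball, of 0 "R + norm v"]
      by (intro integrable_indicator) auto
    show "AE x in lborel. (\<lambda>n. D n x) \<longlonglongrightarrow> g x \<bullet> v"
    proof (intro always_eventually allI)
      fix x
      have "((\<lambda>s. x + s *\<^sub>R v) has_derivative (\<lambda>s. s *\<^sub>R v)) (at 0)"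
        by (auto intro!: derivative_eq_intros)
      moreover have "(\<phi> has_derivative (\<lambda>h. h \<bullet> g x)) (at (x + 0 *\<^sub>R v))"
        using C by (simp add: C1c_with_grad_def gderiv_def)
      ultimately have "((\<lambda>s. \<phi> (x + s *\<^sub>R v)) has_derivative (\<lambda>s. (s *\<^sub>R v) \<bullet> g x)) (at 0)"
        by (rule has_derivative_compose)
      then have "DERIV (\<lambda>s. \<phi> (x + s *\<^sub>R v)) 0 :> g x \<bullet> v"
        by (rule has_derivative_imp_has_field_derivative) (simp add: inner_commute)
      then have "(\<lambda>h. (\<phi> (x + h *\<^sub>R v) - \<phi> x) / h) \<midarrow>0\<rightarrow> g x \<bullet> v" by (simp add: DERIV_def)
      moreover have "filterlim t (at 0) sequentially"
        unfolding filterlim_at using t0 t(1) by (auto intro!: always_eventually simp: less_imp_neq[symmetric])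
      ultimately show "(\<lambda>n. D n x) \<longlonglongrightarrow> g x \<bullet> v"
        unfolding D_def by (subst add.commute) (rule filterlim_compose)
    qed
    show "AE x in lborel. norm (D n x) \<le> indicator (cball 0 (R + norm v)) x *\<^sub>R (M * norm v)" for n
    proof (intro always_eventually allI)
      fix x
      show "norm (D n x) \<le> indicator (cball 0 (R + norm v)) x *\<^sub>R (M * norm v)"
      proof (cases "norm x \<le> R + norm v")
        case True
        have "\<bar>\<phi> (t n *\<^sub>R v + x) - \<phi> x\<bar> \<le> M * norm (t n *\<^sub>R v)" using lip[of "t n *\<^sub>R v + x" x] by simp
        also have "\<dots> = t n * (M * norm v)" using t(1)[of n] by simp
        finally have "norm (D n x) \<le> M * norm v"
          using t(1)[of n] by (simp add: D_def abs_divide pos_divide_le_eq mult.commute)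
        with True show ?thesis by simp
      next
        case False
        have "norm (t n *\<^sub>R v) \<le> norm v" using t[of n] by (simp add: mult_left_le_one_le)
        then have "R < norm (t n *\<^sub>R v + x)" "R < norm x"
          using False norm_triangle_ineq2[of x "- (t n *\<^sub>R v)"] norm_ge_zero[of v]
          by (simp_all add: add.commute[of _ x] del: norm_ge_zero norm_scaleR)
        then have "t n *\<^sub>R v + x \<notin> ?K" "x \<notin> ?K" using R by (auto simp: not_le[symmetric])
        then have "\<phi> (t n *\<^sub>R v + x) = 0" "\<phi> x = 0" by (blast intro: C1c_grad_eq_0[OF C])+
        then show ?thesis using False by (simp add: D_def)
      qed
    qed
  qed
  then have "(LINT x|lborel. g x \<bullet> v) = 0" using LIMSEQ_unique[OF _ tendsto_const] D_int by auto
  then show ?thesis by (subst integral_completion) simp_all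
qed

section \<open>Square integrable fields\<close>

lemma L2_measurable: "f \<in> L2 \<Omega> \<Longrightarrow> f \<in> borel_measurable (lebesgue_on \<Omega>)"
  and L2_integrable: "f \<in> L2 \<Omega> \<Longrightarrow> integrable (lebesgue_on \<Omega>) (\<lambda>x. (norm (f x))\<^sup>2)"
  by (auto simp: L2_def)

text \<open>The main source of square integrable fields below: images under bounded coefficients and products with constants.\<close>

lemma L2_dominated:
  assumes f: "f \<in> L2 \<Omega>" and g: "g \<in> borel_measurable (lebesgue_on \<Omega>)"
    and le: "AE x in lebesgue_on \<Omega>. norm (g x) \<le> c * norm (f x)"
  shows "g \<in> L2 \<Omega>"
proof -
  have [measurable]: "g \<in> borel_measurable (lebesgue_on \<Omega>)" by fact
  have int: "integrable (lebesgue_on \<Omega>) (\<lambda>x. c\<^sup>2 * (norm (f x))\<^sup>2)"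
    using L2_integrable[OF f] by simp
  have bd: "AE x in lebesgue_on \<Omega>. norm ((norm (g x))\<^sup>2) \<le> norm (c\<^sup>2 * (norm (f x))\<^sup>2)"
    using le
  proof eventually_elim
    case (elim x)
    have "(norm (g x))\<^sup>2 \<le> (c * norm (f x))\<^sup>2" by (rule power_mono[OF elim]) simp
    then show ?case by (simp add: power_mult_distrib)
  qed
  have "integrable (lebesgue_on \<Omega>) (\<lambda>x. (norm (g x))\<^sup>2)"
    by (rule Bochner_Integration.integrable_bound[OF int _ bd]) measurable
  then show ?thesis using g by (simp add: L2_def)
qed

lemma L2_scaleR: "f \<in> L2 \<Omega> \<Longrightarrow> (\<lambda>x. c *\<^sub>R f x) \<in> L2 \<Omega>"
  by (rule L2_dominated[where c="\<bar>c\<bar>"]) (auto intro: borel_measurable_scaleR dest: L2_measurable)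

lemma L2_add:
  assumes f: "f \<in> L2 \<Omega>" and g: "g \<in> L2 \<Omega>"
  shows "(\<lambda>x. f x + g x) \<in> L2 \<Omega>"
proof -
  have [measurable]: "f \<in> borel_measurable (lebesgue_on \<Omega>)" "g \<in> borel_measurable (lebesgue_on \<Omega>)"
    using assms by (auto dest: L2_measurable)
  have "integrable (lebesgue_on \<Omega>) (\<lambda>x. 2 * (norm (f x))\<^sup>2 + 2 * (norm (g x))\<^sup>2)"
    using L2_integrable[OF f] L2_integrable[OF g] by simp
  moreover have "norm ((norm (f x + g x))\<^sup>2) \<le> norm (2 * (norm (f x))\<^sup>2 + 2 * (norm (g x))\<^sup>2)" for x
  proof -
    have "(norm (f x + g x))\<^sup>2 + (norm (f x - g x))\<^sup>2 = 2 * (norm (f x))\<^sup>2 + 2 * (norm (g x))\<^sup>2"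
      by (simp add: power2_norm_eq_inner inner_simps inner_commute)
    then have "(norm (f x + g x))\<^sup>2 \<le> 2 * (norm (f x))\<^sup>2 + 2 * (norm (g x))\<^sup>2"
      using zero_le_power2[of "norm (f x - g x)"] by linarith
    then show ?thesis by simp
  qed
  moreover have "(\<lambda>x. (norm (f x + g x))\<^sup>2) \<in> borel_measurable (lebesgue_on \<Omega>)" by measurable
  ultimately have "integrable (lebesgue_on \<Omega>) (\<lambda>x. (norm (f x + g x))\<^sup>2)"
    by (auto intro: Bochner_Integration.integrable_bound)
  then show ?thesis by (simp add: L2_def)
qed

lemma L2_diff: "f \<in> L2 \<Omega> \<Longrightarrow> g \<in> L2 \<Omega> \<Longrightarrow> (\<lambda>x. f x - g x) \<in> L2 \<Omega>"
  using L2_add[of f \<Omega> "\<lambda>x. (-1) *\<^sub>R g x"] L2_scaleR[of g \<Omega> "-1"] by simp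

lemma L2_inner_integrable:
  assumes f: "f \<in> L2 \<Omega>" and g: "g \<in> L2 \<Omega>"
  shows "integrable (lebesgue_on \<Omega>) (\<lambda>x. f x \<bullet> g x)"
proof -
  have [measurable]: "f \<in> borel_measurable (lebesgue_on \<Omega>)" "g \<in> borel_measurable (lebesgue_on \<Omega>)"
    using assms by (auto dest: L2_measurable)
  show ?thesis
  proof (rule Bochner_Integration.integrable_bound)
    show "integrable (lebesgue_on \<Omega>) (\<lambda>x. (norm (f x))\<^sup>2 + (norm (g x))\<^sup>2)"
      using L2_integrable[OF f] L2_integrable[OF g] by simp
    have "norm (f x \<bullet> g x) \<le> norm ((norm (f x))\<^sup>2 + (norm (g x))\<^sup>2)" for x
    proof -
      have "\<bar>f x \<bullet> g x\<bar> \<le> norm (f x) * norm (g x)" by (rule Cauchy_Schwarz_ineq2)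
      also have "\<dots> \<le> (norm (f x))\<^sup>2 + (norm (g x))\<^sup>2"
        using sum_squares_bound[of "norm (f x)" "norm (g x)"]
          mult_nonneg_nonneg[OF norm_ge_zero norm_ge_zero, of "f x" "g x"] by linarith
      finally show ?thesis by simp
    qed
    then show "AE x in lebesgue_on \<Omega>. norm (f x \<bullet> g x) \<le> norm ((norm (f x))\<^sup>2 + (norm (g x))\<^sup>2)" by simp
  qed measurable
qed

lemma l2inner_commute: "l2inner \<Omega> f g = l2inner \<Omega> g f"
  by (simp add: l2inner_def inner_commute)

lemma l2inner_add_left:
  "f \<in> L2 \<Omega> \<Longrightarrow> g \<in> L2 \<Omega> \<Longrightarrow> h \<in> L2 \<Omega> \<Longrightarrow> l2inner \<Omega> (\<lambda>x. f x + g x) h = l2inner \<Omega> f h + l2inner \<Omega> g h"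
  by (simp add: l2inner_def inner_add_left L2_inner_integrable)

lemma l2inner_diff_left:
  "f \<in> L2 \<Omega> \<Longrightarrow> g \<in> L2 \<Omega> \<Longrightarrow> h \<in> L2 \<Omega> \<Longrightarrow> l2inner \<Omega> (\<lambda>x. f x - g x) h = l2inner \<Omega> f h - l2inner \<Omega> g h"
  by (simp add: l2inner_def inner_diff_left L2_inner_integrable)

lemma l2inner_add_right:
  "f \<in> L2 \<Omega> \<Longrightarrow> g \<in> L2 \<Omega> \<Longrightarrow> h \<in> L2 \<Omega> \<Longrightarrow> l2inner \<Omega> h (\<lambda>x. f x + g x) = l2inner \<Omega> h f + l2inner \<Omega> h g"
  by (simp add: l2inner_commute[of _ h] l2inner_add_left)

lemma l2inner_diff_right:
  "f \<in> L2 \<Omega> \<Longrightarrow> g \<in> L2 \<Omega> \<Longrightarrow> h \<in> L2 \<Omega> \<Longrightarrow> l2inner \<Omega> h (\<lambda>x. f x - g x) = l2inner \<Omega> h f - l2inner \<Omega> h g"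
  by (simp add: l2inner_commute[of _ h] l2inner_diff_left)

lemma l2inner_scaleR_left: "l2inner \<Omega> (\<lambda>x. c *\<^sub>R f x) h = c * l2inner \<Omega> f h"
  by (simp add: l2inner_def)

lemma l2inner_scaleR_right: "l2inner \<Omega> h (\<lambda>x. c *\<^sub>R f x) = c * l2inner \<Omega> h f"
  by (simp add: l2inner_def)

lemma l2inner_cong: "(\<And>x. x \<in> \<Omega> \<Longrightarrow> f x \<bullet> g x = f' x \<bullet> g' x) \<Longrightarrow> l2inner \<Omega> f g = l2inner \<Omega> f' g'"
  unfolding l2inner_def by (rule Bochner_Integration.integral_cong) auto

lemma l2norm_nonneg: "0 \<le> l2norm \<Omega> f"
  unfolding l2norm_def by (intro real_sqrt_ge_zero Bochner_Integration.integral_nonneg) auto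

lemma l2norm_sq: "(l2norm \<Omega> f)\<^sup>2 = l2inner \<Omega> f f"
proof -
  have "0 \<le> (LINT x|lebesgue_on \<Omega>. (norm (f x))\<^sup>2)" by (intro Bochner_Integration.integral_nonneg) auto
  then show ?thesis by (simp add: l2norm_def l2inner_def power2_norm_eq_inner)
qed

text \<open>The discriminant argument for \<open>t \<mapsto> (f + t g, f + t g)\<close>, with the degenerate case \<open>\<parallel>g\<parallel> = 0\<close> apart.\<close>

lemma l2_Cauchy_Schwarz:
  assumes f: "f \<in> L2 \<Omega>" and g: "g \<in> L2 \<Omega>"
  shows "\<bar>l2inner \<Omega> f g\<bar> \<le> l2norm \<Omega> f * l2norm \<Omega> g"
proof -
  define a b c where "a = l2inner \<Omega> f f" and "b = l2inner \<Omega> f g" and "c = l2inner \<Omega> g g"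
  have sq: "a = (l2norm \<Omega> f)\<^sup>2" "c = (l2norm \<Omega> g)\<^sup>2" by (auto simp: a_def c_def l2norm_sq)
  then have nn: "0 \<le> a" "0 \<le> c" by auto
  have q: "0 \<le> a + 2 * t * b + t\<^sup>2 * c" for t
  proof -
    have "0 \<le> l2inner \<Omega> (\<lambda>x. f x + t *\<^sub>R g x) (\<lambda>x. f x + t *\<^sub>R g x)"
      unfolding l2norm_sq[symmetric] by simp
    also have "\<dots> = a + 2 * t * b + t\<^sup>2 * c"
      using assms by (simp add: l2inner_add_left l2inner_add_right L2_add L2_scaleR l2inner_scaleR_left
          l2inner_scaleR_right a_def b_def c_def l2inner_commute[of _ g f] power2_eq_square algebra_simps)
    finally show ?thesis .
  qed
  have "b\<^sup>2 \<le> a * c"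
  proof (cases "c = 0")
    case True
    have "b = 0"
    proof (rule ccontr)
      assume "b \<noteq> 0"
      \<comment> \<open>at this \<open>t\<close> the affine function \<open>a + 2 t b\<close> has the value \<open>-1\<close>\<close>
      then show False using q[of "- (a + 1) / (2 * b)"] nn True by (simp add: field_simps)
    qed
    then show ?thesis using nn by simp
  next
    case False
    then have "0 < c" using nn by simp
    then have "0 \<le> c * (a + 2 * (- b / c) * b + (- b / c)\<^sup>2 * c)"
      by (intro mult_nonneg_nonneg q) simp
    also have "\<dots> = a * c - b\<^sup>2" using \<open>0 < c\<close> by (simp add: field_simps power2_eq_square)
    finally show ?thesis by simp
  qed
  then have "\<bar>b\<bar>\<^sup>2 \<le> (l2norm \<Omega> f * l2norm \<Omega> g)\<^sup>2" by (simp add: sq power_mult_distrib)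
  then show ?thesis unfolding b_def
    by (rule power2_le_imp_le) (simp add: l2norm_nonneg)
qed

lemma L2_of_bounded:
  fixes f :: "'a::euclidean_space \<Rightarrow> 'b::euclidean_space"
  assumes "open \<Omega>" "bounded \<Omega>" "f \<in> borel_measurable (lebesgue_on \<Omega>)"
    and "AE x in lebesgue_on \<Omega>. norm (f x) \<le> B"
  shows "f \<in> L2 \<Omega>" "integrable (lebesgue_on \<Omega>) f"
proof -
  interpret finite_measure "lebesgue_on \<Omega>"
    by (rule finite_measure_lebesgue_on) (use assms in \<open>simp add: bounded_set_imp_lmeasurable\<close>)
  have [measurable]: "f \<in> borel_measurable (lebesgue_on \<Omega>)" by fact
  show "integrable (lebesgue_on \<Omega>) f" by (rule integrable_const_bound) fact+
  have "AE x in lebesgue_on \<Omega>. norm ((norm (f x))\<^sup>2) \<le> B\<^sup>2"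
    using assms(4) by eventually_elim (simp add: power_mono)
  then have "integrable (lebesgue_on \<Omega>) (\<lambda>x. (norm (f x))\<^sup>2)"
    by (rule integrable_const_bound) measurable
  then show "f \<in> L2 \<Omega>" by (simp add: L2_def)
qed

lemma L2_imp_integrable:
  fixes f :: "'a::euclidean_space \<Rightarrow> real"
  assumes "open \<Omega>" "bounded \<Omega>" "f \<in> L2 \<Omega>"
  shows "integrable (lebesgue_on \<Omega>) f"
  using L2_inner_integrable[OF \<open>f \<in> L2 \<Omega>\<close> L2_of_bounded(1)[OF assms(1,2), of "\<lambda>x. 1" 1]] by simp

lemma continuous_bounded_L2:
  fixes f :: "'a::euclidean_space \<Rightarrow> 'b::euclidean_space"
  assumes "open \<Omega>" "bounded \<Omega>" "continuous_on UNIV f" "\<And>x. norm (f x) \<le> B"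
  shows "f \<in> L2 \<Omega>"
proof (rule L2_of_bounded(1)[OF assms(1,2)])
  show "f \<in> borel_measurable (lebesgue_on \<Omega>)"
    by (rule continuous_imp_measurable_on_sets_lebesgue[OF continuous_on_subset[OF assms(3)]]) (use assms(1) in auto)
qed (use assms in auto)

lemma C1c_L2:
  fixes \<phi> :: "'a::euclidean_space \<Rightarrow> real"
  assumes "open \<Omega>" "bounded \<Omega>" "C1c_with_grad \<phi> g"
  shows "\<phi> \<in> L2 \<Omega>" "g \<in> L2 \<Omega>"
proof -
  obtain M where M: "0 < M" "\<And>x. \<bar>\<phi> x\<bar> \<le> M" "\<And>x. norm (g x) \<le> M"
    by (rule C1c_bounded[OF assms(3)]) (rule that)
  show "\<phi> \<in> L2 \<Omega>"
    by (rule continuous_bounded_L2[OF assms(1,2) C1c_continuous(1)[OF assms(3)]])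
      (unfold real_norm_def, rule M(2))
  show "g \<in> L2 \<Omega>"
    by (rule continuous_bounded_L2[OF assms(1,2) C1c_continuous(2)[OF assms(3)] M(3)])
qed

lemma C1c_field_L2:
  fixes \<phi> :: "'a::euclidean_space \<Rightarrow> real" and v :: "'b::euclidean_space"
  assumes \<Omega>: "open \<Omega>" "bounded \<Omega>" and C: "C1c_with_grad \<phi> g"
  shows "(\<lambda>x. \<phi> x *\<^sub>R v) \<in> L2 \<Omega>"
  by (rule L2_dominated[OF C1c_L2(1)[OF \<Omega> C], where c="norm v"])
    (auto intro!: borel_measurable_scaleR simp: mult.commute L2_measurable[OF C1c_L2(1)[OF \<Omega> C]])

lemma C1c_directional_derivative_L2:
  fixes \<phi> :: "'a::euclidean_space \<Rightarrow> real"
  assumes \<Omega>: "open \<Omega>" "bounded \<Omega>" and C: "C1c_with_grad \<phi> g"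
  shows "(\<lambda>x. v \<bullet> g x) \<in> L2 \<Omega>"
  by (rule L2_dominated[OF C1c_L2(2)[OF \<Omega> C], where c="norm v"])
    (auto intro!: borel_measurable_inner Cauchy_Schwarz_ineq2 simp: L2_measurable[OF C1c_L2(2)[OF \<Omega> C]])

section \<open>Weak divergence of localised constant fields\<close>

text \<open>The difference of two weak divergences annihilates all squares \<open>\<phi>\<^sup>2\<close>, so it is both nonnegative and
  nonpositive.\<close>

lemma weak_div_unique:
  fixes \<Omega> :: "'a::euclidean_space set"
  assumes \<Omega>: "open \<Omega>" "bounded \<Omega>" and f: "f1 \<in> L2 \<Omega>" "f2 \<in> L2 \<Omega>"
    and "is_weak_div \<Omega> q f1" "is_weak_div \<Omega> q f2"
  shows "AE x in lebesgue_on \<Omega>. f1 x = f2 x"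
proof -
  have *: "AE x in lebesgue_on \<Omega>. 0 \<le> e x - d x"
    if "d \<in> L2 \<Omega>" "e \<in> L2 \<Omega>" "is_weak_div \<Omega> q d" "is_weak_div \<Omega> q e" for d e
  proof (rule AE_nonneg_of_C1c_tests[OF \<Omega>(1)])
    show "integrable (lebesgue_on \<Omega>) (\<lambda>x. e x - d x)"
      using that by (intro L2_imp_integrable[OF \<Omega>] L2_diff)
    fix \<phi> g assume C: "C1c_with_grad \<phi> g" "closure {x. \<phi> x \<noteq> 0} \<subseteq> \<Omega>"
    note sq = C1c_mult[OF C(1) C(1)]
    have "l2inner \<Omega> q (\<lambda>x. \<phi> x *\<^sub>R g x + \<phi> x *\<^sub>R g x) = - l2inner \<Omega> s (\<lambda>x. \<phi> x * \<phi> x)"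
      if "is_weak_div \<Omega> q s" for s
      using that sq(1) order_trans[OF sq(2) C(2)] unfolding is_weak_div_def by blast
    from this[OF that(3)] this[OF that(4)]
    have "l2inner \<Omega> d (\<lambda>x. \<phi> x * \<phi> x) = l2inner \<Omega> e (\<lambda>x. \<phi> x * \<phi> x)" by simp
    then have "l2inner \<Omega> (\<lambda>x. e x - d x) (\<lambda>x. \<phi> x * \<phi> x) = 0"
      using that C1c_L2[OF \<Omega> sq(1)] by (simp add: l2inner_diff_left)
    then show "0 \<le> (LINT x|lebesgue_on \<Omega>. (\<phi> x)\<^sup>2 * (e x - d x))"
      by (simp add: l2inner_def power2_eq_square mult.commute)
  qed
  have "AE x in lebesgue_on \<Omega>. 0 \<le> f1 x - f2 x" "AE x in lebesgue_on \<Omega>. 0 \<le> f2 x - f1 x"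
    using *[of f1 f2] *[of f2 f1] assms by auto
  then show ?thesis by eventually_elim simp
qed

lemma wdiv_Hdiv:
  assumes "q \<in> Hdiv \<Omega>"
  shows "wdiv \<Omega> q \<in> L2 \<Omega>" "is_weak_div \<Omega> q (wdiv \<Omega> q)"
proof -
  have "\<exists>f. f \<in> L2 \<Omega> \<and> is_weak_div \<Omega> q f" using assms by (auto simp: Hdiv_def)
  from someI_ex[OF this] show "wdiv \<Omega> q \<in> L2 \<Omega>" "is_weak_div \<Omega> q (wdiv \<Omega> q)"
    by (auto simp: wdiv_def)
qed

text \<open>The integrand is the derivative of \<open>\<phi> \<psi>\<close> in direction \<open>v\<close>. Leaving \<open>\<psi>\<close> free up to
  and beyond the boundary is what the normal trace condition requires.\<close>

lemma C1c_Green: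
  fixes \<Omega> :: "'a::euclidean_space set"
  assumes \<Omega>: "open \<Omega>" "bounded \<Omega>" and C: "C1c_with_grad \<phi> g" "closure {x. \<phi> x \<noteq> 0} \<subseteq> \<Omega>"
    and D: "C1c_with_grad \<psi> k"
  shows "l2inner \<Omega> (\<lambda>x. \<phi> x *\<^sub>R v) k + l2inner \<Omega> (\<lambda>x. v \<bullet> g x) \<psi> = 0"
proof -
  note L2 = C1c_field_L2[OF \<Omega> C(1), of v] and L2' = C1c_directional_derivative_L2[OF \<Omega> C(1), of v]
  have "0 = (LINT x|lebesgue. (\<phi> x *\<^sub>R k x + \<psi> x *\<^sub>R g x) \<bullet> v)"
    using integral_directional_derivative_C1c[OF C1c_mult(1)[OF C(1) D]] by simp
  also have "(\<lambda>x. (\<phi> x *\<^sub>R k x + \<psi> x *\<^sub>R g x) \<bullet> v) =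
      (\<lambda>x. if x \<in> \<Omega> then (\<phi> x *\<^sub>R v) \<bullet> k x + (v \<bullet> g x) \<bullet> \<psi> x else 0)"
  proof
    fix x
    show "(\<phi> x *\<^sub>R k x + \<psi> x *\<^sub>R g x) \<bullet> v = (if x \<in> \<Omega> then (\<phi> x *\<^sub>R v) \<bullet> k x + (v \<bullet> g x) \<bullet> \<psi> x else 0)"
    proof (cases "x \<in> \<Omega>")
      case False
      then have "x \<notin> closure {x. \<phi> x \<noteq> 0}" using C(2) by blast
      then have "\<phi> x = 0" "g x = 0" by (blast intro: C1c_grad_eq_0[OF C(1)])+
      with False show ?thesis by simp
    qed (simp add: inner_simps inner_commute)
  qed
  also have "integral\<^sup>L lebesgue \<dots> = (LINT x|lebesgue_on \<Omega>. (\<phi> x *\<^sub>R v) \<bullet> k x + (v \<bullet> g x) \<bullet> \<psi> x)"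
    by (rule Lebesgue_Measure.integral_restrict_UNIV) (use \<Omega>(1) in auto)
  also have "\<dots> = l2inner \<Omega> (\<lambda>x. \<phi> x *\<^sub>R v) k + l2inner \<Omega> (\<lambda>x. v \<bullet> g x) \<psi>"
    unfolding l2inner_def
    by (intro Bochner_Integration.integral_add L2_inner_integrable L2 L2' C1c_L2[OF \<Omega> D])
  finally show ?thesis by simp
qed

text \<open>Green's formula gives the weak divergence \<open>v \<bullet> \<nabla>\<phi>\<close>. Uniqueness identifies it with the chosen
  representative in the definition of the normal trace, which vanishes by Green's formula again.\<close>

lemma C1c_field_Hdiv:
  fixes \<Omega> :: "'a::euclidean_space set"
  assumes \<Omega>: "open \<Omega>" "bounded \<Omega>" and C: "C1c_with_grad \<phi> g" "closure {x. \<phi> x \<noteq> 0} \<subseteq> \<Omega>"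
  shows "(\<lambda>x. \<phi> x *\<^sub>R v) \<in> Hdiv \<Omega>" "normal_trace_zero_on \<Omega> \<Gamma> (\<lambda>x. \<phi> x *\<^sub>R v)"
proof -
  note L2 = C1c_field_L2[OF \<Omega> C(1), of v] and L2' = C1c_directional_derivative_L2[OF \<Omega> C(1), of v]
  note Green = C1c_Green[OF \<Omega> C, of _ _ v]
  have wd: "is_weak_div \<Omega> (\<lambda>x. \<phi> x *\<^sub>R v) (\<lambda>x. v \<bullet> g x)"
    unfolding is_weak_div_def using Green by (simp add: add_eq_0_iff2)
  show H: "(\<lambda>x. \<phi> x *\<^sub>R v) \<in> Hdiv \<Omega>" using L2 L2' wd by (auto simp: Hdiv_def)
  have eq: "AE x in lebesgue_on \<Omega>. wdiv \<Omega> (\<lambda>x. \<phi> x *\<^sub>R v) x = v \<bullet> g x"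
    by (rule weak_div_unique[OF \<Omega> wdiv_Hdiv(1)[OF H] L2' wdiv_Hdiv(2)[OF H] wd])
  show "normal_trace_zero_on \<Omega> \<Gamma> (\<lambda>x. \<phi> x *\<^sub>R v)"
    unfolding normal_trace_zero_on_def
  proof (intro allI impI)
    fix \<psi> k assume D: "C1c_with_grad \<psi> k \<and> closure {x. \<psi> x \<noteq> 0} \<inter> frontier \<Omega> \<subseteq> \<Gamma>"
    then have \<psi>: "\<psi> \<in> L2 \<Omega>" using C1c_L2[OF \<Omega>] by blast
    have "l2inner \<Omega> (wdiv \<Omega> (\<lambda>x. \<phi> x *\<^sub>R v)) \<psi> = l2inner \<Omega> (\<lambda>x. v \<bullet> g x) \<psi>"
      unfolding l2inner_def
    proof (rule integral_cong_AE)
      show "AE x in lebesgue_on \<Omega>. wdiv \<Omega> (\<lambda>x. \<phi> x *\<^sub>R v) x \<bullet> \<psi> x = (v \<bullet> g x) \<bullet> \<psi> x"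
        using eq by eventually_elim simp
      show "(\<lambda>x. wdiv \<Omega> (\<lambda>x. \<phi> x *\<^sub>R v) x \<bullet> \<psi> x) \<in> borel_measurable (lebesgue_on \<Omega>)"
        by (rule borel_measurable_integrable[OF L2_inner_integrable[OF wdiv_Hdiv(1)[OF H] \<psi>]])
      show "(\<lambda>x. (v \<bullet> g x) \<bullet> \<psi> x) \<in> borel_measurable (lebesgue_on \<Omega>)"
        by (rule borel_measurable_integrable[OF L2_inner_integrable[OF L2' \<psi>]])
    qed
    then show "l2inner \<Omega> (\<lambda>x. \<phi> x *\<^sub>R v) k + l2inner \<Omega> (wdiv \<Omega> (\<lambda>x. \<phi> x *\<^sub>R v)) \<psi> = 0"
      using Green[of \<psi> k] D by simp
  qed
qed

lemma C1c_field_velocity_space: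
  assumes "open \<Omega>" "bounded \<Omega>" "C1c_with_grad \<phi> g" "closure {x. \<phi> x \<noteq> 0} \<subseteq> \<Omega>"
  shows "(\<lambda>x. \<phi> x *\<^sub>R v) \<in> velocity_space \<Omega> \<Gamma>"
  using C1c_field_Hdiv[OF assms] by (simp add: velocity_space_def)

lemma C1c_field_stress_space:
  assumes "open \<Omega>" "bounded \<Omega>" "C1c_with_grad \<phi> g" "closure {x. \<phi> x \<noteq> 0} \<subseteq> \<Omega>"
  shows "(\<lambda>x. \<phi> x *\<^sub>R M) \<in> stress_space \<Omega> \<Gamma>"
  using C1c_field_Hdiv[OF assms] by (simp add: stress_space_def)

section \<open>Measurability of fields\<close>

text \<open>Lebesgue measure is complete. This is needed for fields that are given by a formula only at almost every
  point, such as the inverse permeability.\<close>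

lemma borel_measurable_lebesgue_on_AE:
  fixes f g :: "'a::euclidean_space \<Rightarrow> 'b::euclidean_space"
  assumes "\<Omega> \<in> sets lebesgue" "f \<in> borel_measurable (lebesgue_on \<Omega>)" "AE x in lebesgue_on \<Omega>. f x = g x"
  shows "g \<in> borel_measurable (lebesgue_on \<Omega>)"
proof -
  have "AE x in lebesgue. x \<in> \<Omega> \<longrightarrow> f x = g x" using assms(1,3) by (simp add: AE_restrict_space_iff)
  then have "AE x in lebesgue. (if x \<in> \<Omega> then f x else 0) = (if x \<in> \<Omega> then g x else 0)"
    by eventually_elim simp
  then have "(\<lambda>x. if x \<in> \<Omega> then g x else 0) \<in> borel_measurable lebesgue"
    by (rule borel_measurable_AE[OF borel_measurable_if_I[OF assms(2,1)]])
  then show ?thesis by (rule borel_measurable_if_D)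
qed

lemma borel_measurable_vec_lambda:
  fixes f :: "'n::finite \<Rightarrow> 'a \<Rightarrow> 'b::euclidean_space"
  assumes "\<And>i. f i \<in> borel_measurable M"
  shows "(\<lambda>x. \<chi> i. f i x) \<in> borel_measurable M"
proof (subst borel_measurable_euclidean_space, intro ballI)
  fix b :: "'b^'n" assume "b \<in> Basis"
  then obtain i u where "b = axis i u" by (auto simp: Basis_vec_def)
  moreover have "(\<lambda>x. f i x \<bullet> u) \<in> borel_measurable M"
    using assms[of i] by (rule borel_measurable_inner) simp
  ultimately show "(\<lambda>x. (\<chi> i. f i x) \<bullet> b) \<in> borel_measurable M" by (simp add: inner_axis)
qed

lemma L2_vec_lambda:
  fixes f :: "'n::finite \<Rightarrow> 'a::euclidean_space \<Rightarrow> 'b::euclidean_space"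
  assumes "\<And>i. f i \<in> L2 \<Omega>"
  shows "(\<lambda>x. \<chi> i. f i x) \<in> L2 \<Omega>"
proof -
  have "(\<lambda>x. (norm (\<chi> i. f i x))\<^sup>2) = (\<lambda>x. \<Sum>i\<in>UNIV. (norm (f i x))\<^sup>2)"
    by (auto simp: norm_vec_def L2_set_def sum_nonneg)
  then have "integrable (lebesgue_on \<Omega>) (\<lambda>x. (norm (\<chi> i. f i x))\<^sup>2)"
    using L2_integrable[OF assms] by simp
  then show ?thesis
    using borel_measurable_vec_lambda[of f, OF L2_measurable[OF assms]] by (simp add: L2_def)
qed

lemma velocity_space_L2:
  assumes "q \<in> velocity_space \<Omega> \<Gamma>"
  shows "q \<in> L2 \<Omega>" "wdiv \<Omega> q \<in> L2 \<Omega>"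
  using assms wdiv_Hdiv(1)[of q \<Omega>] by (auto simp: velocity_space_def Hdiv_def)

lemma stress_space_L2:
  assumes "\<tau> \<in> stress_space \<Omega> \<Gamma>"
  shows "\<tau> \<in> L2 \<Omega>" "wdiv_mat \<Omega> \<tau> \<in> L2 \<Omega>"
proof -
  have H: "(\<lambda>x. \<tau> x $ i) \<in> Hdiv \<Omega>" for i using assms by (simp add: stress_space_def)
  then have "(\<lambda>x. \<chi> i. \<tau> x $ i) \<in> L2 \<Omega>" by (intro L2_vec_lambda) (auto simp: Hdiv_def)
  then show "\<tau> \<in> L2 \<Omega>" by simp
  show "wdiv_mat \<Omega> \<tau> \<in> L2 \<Omega>"
    unfolding wdiv_mat_def by (intro L2_vec_lambda wdiv_Hdiv H)
qed

lemma l2norm_le_hdiv_norm: "l2norm \<Omega> q \<le> hdiv_norm \<Omega> q" "l2norm \<Omega> \<tau> \<le> hdiv_norm_mat \<Omega> \<tau>"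
  by (auto simp: hdiv_norm_def hdiv_norm_mat_def intro!: real_le_rsqrt)

text \<open>Expand the argument in the basis; pointwise linearity reduces the claim to constant arguments.\<close>

lemma borel_measurable_apply_linear:
  fixes B :: "'a::euclidean_space \<Rightarrow> 'b::euclidean_space \<Rightarrow> 'c::euclidean_space"
  assumes "\<And>v. (\<lambda>x. B x v) \<in> borel_measurable (lebesgue_on \<Omega>)" "\<And>x. x \<in> \<Omega> \<Longrightarrow> linear (B x)"
    and "f \<in> borel_measurable (lebesgue_on \<Omega>)"
  shows "(\<lambda>x. B x (f x)) \<in> borel_measurable (lebesgue_on \<Omega>)"
proof -
  have "(\<lambda>x. \<Sum>b\<in>Basis. (f x \<bullet> b) *\<^sub>R B x b) \<in> borel_measurable (lebesgue_on \<Omega>)"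
    using assms(1,3) by (intro borel_measurable_sum borel_measurable_scaleR borel_measurable_inner) auto
  moreover have "(\<Sum>b\<in>Basis. (f x \<bullet> b) *\<^sub>R B x b) = B x (f x)" if "x \<in> \<Omega>" for x
  proof -
    have "B x (f x) = B x (\<Sum>b\<in>Basis. (f x \<bullet> b) *\<^sub>R b)" by (simp add: euclidean_representation)
    also have "\<dots> = (\<Sum>b\<in>Basis. (f x \<bullet> b) *\<^sub>R B x b)"
      using assms(2)[OF that] by (simp add: linear_sum linear_cmul)
    finally show ?thesis by simp
  qed
  ultimately show ?thesis
    by (subst (asm) measurable_lebesgue_cong[where g="\<lambda>x. B x (f x)"])
qed

section \<open>Pointwise bounds of the coefficients\<close>

text \<open>For a fixed vector \<open>v\<close> the test inequality localises to almost every point. The exceptional null sets of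
  countably many dense vectors can be united, and continuity in \<open>v\<close> does the rest.\<close>

lemma AE_psd_of_C1c_tests:
  fixes Q :: "'a::euclidean_space \<Rightarrow> 'b::euclidean_space \<Rightarrow> 'b"
  assumes \<Omega>: "open \<Omega>" "bounded \<Omega>"
    and meas: "\<And>v. (\<lambda>x. Q x v) \<in> borel_measurable (lebesgue_on \<Omega>)"
    and lin: "\<And>x. x \<in> \<Omega> \<Longrightarrow> linear (Q x)"
    and bd: "AE x in lebesgue_on \<Omega>. \<forall>v. norm (Q x v) \<le> b * norm v"
    and test: "\<And>\<phi> g v. C1c_with_grad \<phi> g \<Longrightarrow> closure {x. \<phi> x \<noteq> 0} \<subseteq> \<Omega> \<Longrightarrow>
      0 \<le> l2inner \<Omega> (\<lambda>x. Q x (\<phi> x *\<^sub>R v)) (\<lambda>x. \<phi> x *\<^sub>R v)"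
  shows "AE x in lebesgue_on \<Omega>. \<forall>v. 0 \<le> Q x v \<bullet> v"
proof -
  obtain D :: "'b set" where D: "countable D" "\<And>X. open X \<Longrightarrow> X \<noteq> {} \<Longrightarrow> \<exists>d\<in>D. d \<in> X"
    by (rule countable_dense_setE) (rule that)
  have "AE x in lebesgue_on \<Omega>. 0 \<le> Q x v \<bullet> v" for v
  proof (rule AE_nonneg_of_C1c_tests[OF \<Omega>(1)])
    show "integrable (lebesgue_on \<Omega>) (\<lambda>x. Q x v \<bullet> v)"
    proof (rule L2_of_bounded(2)[OF \<Omega>])
      show "(\<lambda>x. Q x v \<bullet> v) \<in> borel_measurable (lebesgue_on \<Omega>)"
        using meas by (intro borel_measurable_inner) auto
      show "AE x in lebesgue_on \<Omega>. norm (Q x v \<bullet> v) \<le> b * norm v * norm v"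
        using bd
      proof eventually_elim
        case (elim x)
        then show ?case
          using Cauchy_Schwarz_ineq2[of "Q x v" v] mult_right_mono[of "norm (Q x v)" "b * norm v" "norm v"]
          by (metis norm_ge_zero order_trans real_norm_def)
      qed
    qed
    fix \<phi> g assume "C1c_with_grad \<phi> g" "closure {x. \<phi> x \<noteq> 0} \<subseteq> \<Omega>"
    then have "0 \<le> l2inner \<Omega> (\<lambda>x. Q x (\<phi> x *\<^sub>R v)) (\<lambda>x. \<phi> x *\<^sub>R v)" by (rule test)
    also have "\<dots> = l2inner \<Omega> (\<lambda>x. (\<phi> x)\<^sup>2 *\<^sub>R Q x v) (\<lambda>x. v)"
      by (rule l2inner_cong) (simp add: linear_cmul[OF lin] power2_eq_square)
    finally show "0 \<le> (LINT x|lebesgue_on \<Omega>. (\<phi> x)\<^sup>2 * (Q x v \<bullet> v))" by (simp add: l2inner_def)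
  qed
  then have "AE x in lebesgue_on \<Omega>. \<forall>d\<in>D. 0 \<le> Q x d \<bullet> d" by (simp add: AE_ball_countable[OF D(1)])
  then show ?thesis
  proof (rule lebesgue_on_mono)
    fix x assume pos: "\<forall>d\<in>D. 0 \<le> Q x d \<bullet> d" and "x \<in> \<Omega>"
    have bl: "bounded_linear (Q x)" using lin[OF \<open>x \<in> \<Omega>\<close>] by (simp add: linear_conv_bounded_linear)
    have "continuous_on UNIV (\<lambda>v. Q x v \<bullet> v)"
      by (rule continuous_on_inner[OF linear_continuous_on[OF bl] continuous_on_id])
    then have op: "open {v. Q x v \<bullet> v < 0}" by (rule open_Collect_less) (rule continuous_on_const)
    show "\<forall>v. 0 \<le> Q x v \<bullet> v"
    proof (rule ccontr)
      assume "\<not> ?thesis"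
      then have "{v. Q x v \<bullet> v < 0} \<noteq> {}" by (auto simp: not_le)
      with D(2)[OF op] pos show False by fastforce
    qed
  qed
qed

lemma AE_quadratic_form_bounds:
  fixes Q :: "'a::euclidean_space \<Rightarrow> 'b::euclidean_space \<Rightarrow> 'b"
  assumes \<Omega>: "open \<Omega>" "bounded \<Omega>"
    and meas: "\<And>v. (\<lambda>x. Q x v) \<in> borel_measurable (lebesgue_on \<Omega>)"
    and lin: "\<And>x. x \<in> \<Omega> \<Longrightarrow> linear (Q x)"
    and bd: "AE x in lebesgue_on \<Omega>. \<forall>v. norm (Q x v) \<le> b * norm v"
    and lo: "\<And>\<phi> g v. C1c_with_grad \<phi> g \<Longrightarrow> closure {x. \<phi> x \<noteq> 0} \<subseteq> \<Omega> \<Longrightarrow>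
      lo * (l2norm \<Omega> (\<lambda>x. \<phi> x *\<^sub>R v))\<^sup>2 \<le> l2inner \<Omega> (\<lambda>x. Q x (\<phi> x *\<^sub>R v)) (\<lambda>x. \<phi> x *\<^sub>R v)"
    and hi: "\<And>\<phi> g v. C1c_with_grad \<phi> g \<Longrightarrow> closure {x. \<phi> x \<noteq> 0} \<subseteq> \<Omega> \<Longrightarrow>
      l2inner \<Omega> (\<lambda>x. Q x (\<phi> x *\<^sub>R v)) (\<lambda>x. \<phi> x *\<^sub>R v) \<le> hi * (l2norm \<Omega> (\<lambda>x. \<phi> x *\<^sub>R v))\<^sup>2"
  shows "AE x in lebesgue_on \<Omega>. \<forall>v. lo * (norm v)\<^sup>2 \<le> Q x v \<bullet> v \<and> Q x v \<bullet> v \<le> hi * (norm v)\<^sup>2"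
proof -
  have tL2: "(\<lambda>x. \<phi> x *\<^sub>R v) \<in> L2 \<Omega>" "(\<lambda>x. Q x (\<phi> x *\<^sub>R v)) \<in> L2 \<Omega>"
    if "C1c_with_grad \<phi> g" for \<phi> g and v :: 'b
  proof -
    show *: "(\<lambda>x. \<phi> x *\<^sub>R v) \<in> L2 \<Omega>" by (rule C1c_field_L2[OF \<Omega> that])
    show "(\<lambda>x. Q x (\<phi> x *\<^sub>R v)) \<in> L2 \<Omega>"
    proof (rule L2_dominated[OF *])
      show "(\<lambda>x. Q x (\<phi> x *\<^sub>R v)) \<in> borel_measurable (lebesgue_on \<Omega>)"
        by (rule borel_measurable_apply_linear[OF meas lin L2_measurable[OF *]])
      show "AE x in lebesgue_on \<Omega>. norm (Q x (\<phi> x *\<^sub>R v)) \<le> b * norm (\<phi> x *\<^sub>R v)"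
        using bd by (rule lebesgue_on_mono) blast
    qed
  qed
  have "AE x in lebesgue_on \<Omega>. \<forall>v. 0 \<le> (Q x v - lo *\<^sub>R v) \<bullet> v"
  proof (rule AE_psd_of_C1c_tests[OF \<Omega>])
    show "AE x in lebesgue_on \<Omega>. \<forall>v. norm (Q x v - lo *\<^sub>R v) \<le> (b + \<bar>lo\<bar>) * norm v"
      using bd
    proof (rule lebesgue_on_mono, intro allI)
      fix x v assume "\<forall>v. norm (Q x v) \<le> b * norm v"
      then show "norm (Q x v - lo *\<^sub>R v) \<le> (b + \<bar>lo\<bar>) * norm v"
        using norm_triangle_ineq4[of "Q x v" "lo *\<^sub>R v"] by (fastforce simp: distrib_right intro: order_trans)
    qed
    fix \<phi> g v assume C: "C1c_with_grad \<phi> g" "closure {x. \<phi> x \<noteq> 0} \<subseteq> \<Omega>"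
    show "0 \<le> l2inner \<Omega> (\<lambda>x. Q x (\<phi> x *\<^sub>R v) - lo *\<^sub>R \<phi> x *\<^sub>R v) (\<lambda>x. \<phi> x *\<^sub>R v)"
      using lo[OF C, of v] tL2[OF C(1), of v]
      by (subst l2inner_diff_left) (auto simp: l2inner_scaleR_left l2norm_sq simp del: scaleR_scaleR intro: L2_scaleR)
  next
    show "(\<lambda>x. Q x v - lo *\<^sub>R v) \<in> borel_measurable (lebesgue_on \<Omega>)" for v
      using meas by (intro borel_measurable_diff) auto
    show "linear (\<lambda>v. Q x v - lo *\<^sub>R v)" if "x \<in> \<Omega>" for x
      using lin[OF that] by (intro linear_compose_sub linear_scaleR)
  qed
  moreover have "AE x in lebesgue_on \<Omega>. \<forall>v. 0 \<le> (hi *\<^sub>R v - Q x v) \<bullet> v"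
  proof (rule AE_psd_of_C1c_tests[OF \<Omega>])
    show "AE x in lebesgue_on \<Omega>. \<forall>v. norm (hi *\<^sub>R v - Q x v) \<le> (b + \<bar>hi\<bar>) * norm v"
      using bd
    proof (rule lebesgue_on_mono, intro allI)
      fix x v assume "\<forall>v. norm (Q x v) \<le> b * norm v"
      then show "norm (hi *\<^sub>R v - Q x v) \<le> (b + \<bar>hi\<bar>) * norm v"
        using norm_triangle_ineq4[of "hi *\<^sub>R v" "Q x v"] by (fastforce simp: distrib_right intro: order_trans)
    qed
    fix \<phi> g v assume C: "C1c_with_grad \<phi> g" "closure {x. \<phi> x \<noteq> 0} \<subseteq> \<Omega>"
    show "0 \<le> l2inner \<Omega> (\<lambda>x. hi *\<^sub>R \<phi> x *\<^sub>R v - Q x (\<phi> x *\<^sub>R v)) (\<lambda>x. \<phi> x *\<^sub>R v)"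
      using hi[OF C, of v] tL2[OF C(1), of v]
      by (subst l2inner_diff_left) (auto simp: l2inner_scaleR_left l2norm_sq simp del: scaleR_scaleR intro: L2_scaleR)
  next
    show "(\<lambda>x. hi *\<^sub>R v - Q x v) \<in> borel_measurable (lebesgue_on \<Omega>)" for v
      using meas by (intro borel_measurable_diff) auto
    show "linear (\<lambda>v. hi *\<^sub>R v - Q x v)" if "x \<in> \<Omega>" for x
      using lin[OF that] by (intro linear_compose_sub linear_scaleR)
  qed
  ultimately show ?thesis
    by eventually_elim (auto simp: inner_diff_left power2_norm_eq_inner)
qed

lemma compliance_pointwise_bounds:
  assumes \<Omega>: "open \<Omega>" "bounded \<Omega>" and A: "compliance_tensor \<Omega> A" "compliance_bounds \<Omega> \<Gamma> A a_min a_max"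
  shows "AE x in lebesgue_on \<Omega>. \<forall>\<tau>. a_min * (norm \<tau>)\<^sup>2 \<le> A x \<tau> \<bullet> \<tau> \<and> A x \<tau> \<bullet> \<tau> \<le> a_max * (norm \<tau>)\<^sup>2"
proof -
  obtain b where "AE x in lebesgue_on \<Omega>. \<forall>\<tau>. norm (A x \<tau>) \<le> b * norm \<tau>"
    using A(1) by (auto simp: compliance_tensor_def)
  then show ?thesis
    by (rule AE_quadratic_form_bounds[OF \<Omega>, rotated 2])
      (use A C1c_field_stress_space[OF \<Omega>] in \<open>auto simp: compliance_tensor_def compliance_bounds_def\<close>)
qed

lemma norm_matrix_vector_mult_le:
  fixes M :: "real^'n^'m"
  shows "norm (M *v v) \<le> norm M * norm v"
proof -
  have "norm (M *v v) = L2_set (\<lambda>i. norm (M $ i \<bullet> v)) UNIV"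
    by (simp add: norm_vec_def matrix_vector_mul_component)
  also have "\<dots> \<le> L2_set (\<lambda>i. norm (M $ i) * norm v) UNIV"
    by (intro L2_set_mono) (auto intro: Cauchy_Schwarz_ineq2)
  also have "\<dots> = norm M * norm v" by (simp add: norm_vec_def[of M] L2_set_left_distrib)
  finally show ?thesis .
qed

lemma permeability_pointwise_bounds:
  fixes \<Omega> :: "(real^'d) set"
  assumes \<Omega>: "open \<Omega>" "bounded \<Omega>" and K: "permeability_tensor \<Omega> K" "permeability_bounds \<Omega> \<Gamma> K k_min k_max"
  shows "AE x in lebesgue_on \<Omega>. \<forall>v. k_min * (norm v)\<^sup>2 \<le> (K x *v v) \<bullet> v \<and> (K x *v v) \<bullet> v \<le> k_max * (norm v)\<^sup>2"
proof -
  have Km: "K \<in> borel_measurable (lebesgue_on \<Omega>)" using K(1) by (simp add: permeability_tensor_def)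
  obtain b where b: "AE x in lebesgue_on \<Omega>. norm (K x) \<le> b"
    using K(1) by (auto simp: permeability_tensor_def)
  have bound: "AE x in lebesgue_on \<Omega>. \<forall>v. norm (K x *v v) \<le> b * norm v"
    using b
  proof (rule lebesgue_on_mono, intro allI)
    fix x v assume "norm (K x) \<le> b"
    then show "norm (K x *v v) \<le> b * norm v"
      by (intro order_trans[OF norm_matrix_vector_mult_le] mult_right_mono) auto
  qed
  have meas: "(\<lambda>x. K x *v v) \<in> borel_measurable (lebesgue_on \<Omega>)" for v
  proof (rule borel_measurable_continuous_on[OF _ Km])
    show "continuous_on UNIV (\<lambda>M::real^'d^'d. M *v v)"
      unfolding matrix_vector_mult_def by (intro continuous_intros)
  qed
  show ?thesis
    by (rule AE_quadratic_form_bounds[OF \<Omega> meas _ bound])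
      (use K(2) C1c_field_velocity_space[OF \<Omega>] in \<open>auto simp: permeability_bounds_def\<close>)
qed

text \<open>Cramer's rule expresses the inverse as a quotient of determinants wherever it exists.\<close>

lemma borel_measurable_matrix_inv_mult:
  fixes K :: "real^'d \<Rightarrow> real^'d^'d"
  assumes \<Omega>: "\<Omega> \<in> sets lebesgue" and K: "K \<in> borel_measurable (lebesgue_on \<Omega>)"
    and inv: "AE x in lebesgue_on \<Omega>. det (K x) \<noteq> 0 \<and> K x *v (matrix_inv (K x) *v v) = v"
  shows "(\<lambda>x. matrix_inv (K x) *v v) \<in> borel_measurable (lebesgue_on \<Omega>)"
proof (rule borel_measurable_lebesgue_on_AE[OF \<Omega>])
  have comp: "(\<lambda>x. K x $ i $ j) \<in> borel_measurable (lebesgue_on \<Omega>)" for i j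
    by (rule borel_measurable_continuous_on[OF _ K, of "\<lambda>M. M $ i $ j"]) (intro continuous_intros)
  have det: "(\<lambda>x. det (F x)) \<in> borel_measurable (lebesgue_on \<Omega>)"
    if "\<And>i j. (\<lambda>x. F x $ i $ j) \<in> borel_measurable (lebesgue_on \<Omega>)" for F :: "real^'d \<Rightarrow> real^'d^'d"
    unfolding det_def using that
    by (intro borel_measurable_sum borel_measurable_times borel_measurable_prod) auto
  show "(\<lambda>x. \<chi> k. det (\<chi> i j. if j = k then v $ i else K x $ i $ j) / det (K x)) \<in> borel_measurable (lebesgue_on \<Omega>)"
  proof (intro borel_measurable_vec_lambda borel_measurable_divide det)
    show "(\<lambda>x. (\<chi> i j. if j = k then v $ i else K x $ i $ j) $ i $ j) \<in> borel_measurable (lebesgue_on \<Omega>)"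
      for i j k by (cases "j = k") (simp_all add: comp)
  qed (rule comp)
  show "AE x in lebesgue_on \<Omega>. (\<chi> k. det (\<chi> i j. if j = k then v $ i else K x $ i $ j) / det (K x)) = matrix_inv (K x) *v v"
    using inv
  proof eventually_elim
    case (elim x)
    then show ?case using cramer[of "K x", THEN iffD1, symmetric] by blast
  qed
qed

section \<open>Quadratic forms of coefficient fields\<close>

text \<open>The bound \<open>\<bar>B v\<bar>\<^sup>2 \<le> c (B v \<bullet> v)\<close> encodes semidefiniteness and boundedness at once. It holds for the
  compliance with \<open>c = a_max\<close> and for the inverse permeability with \<open>c = 1 / k_min\<close>, so one development serves both.
  Symmetry and the bound are required only almost everywhere, since \<open>K\<close> need not be invertible on a
  null set.\<close>

locale coefficient_field =
  fixes \<Omega> :: "'a::euclidean_space set" and B :: "'a \<Rightarrow> 'b::euclidean_space \<Rightarrow> 'b" and c :: real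
  assumes meas: "\<And>v. (\<lambda>x. B x v) \<in> borel_measurable (lebesgue_on \<Omega>)"
    and lin: "\<And>x. x \<in> \<Omega> \<Longrightarrow> linear (B x)"
    and sym: "AE x in lebesgue_on \<Omega>. \<forall>v w. B x v \<bullet> w = v \<bullet> B x w"
    and bound: "AE x in lebesgue_on \<Omega>. \<forall>v. (norm (B x v))\<^sup>2 \<le> c * (B x v \<bullet> v)"
    and c_pos: "0 < c"
begin

definition form :: "('a \<Rightarrow> 'b) \<Rightarrow> ('a \<Rightarrow> 'b) \<Rightarrow> real" where
  "form f g = l2inner \<Omega> (\<lambda>x. B x (f x)) g"

lemma apply_L2:
  assumes f: "f \<in> L2 \<Omega>"
  shows "(\<lambda>x. B x (f x)) \<in> L2 \<Omega>"
proof (rule L2_dominated[OF f])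
  show "(\<lambda>x. B x (f x)) \<in> borel_measurable (lebesgue_on \<Omega>)"
    by (rule borel_measurable_apply_linear[OF meas lin L2_measurable[OF f]])
  show "AE x in lebesgue_on \<Omega>. norm (B x (f x)) \<le> c * norm (f x)"
    using bound
  proof eventually_elim
    case (elim x)
    have "(norm (B x (f x)))\<^sup>2 \<le> c * (B x (f x) \<bullet> f x)" using elim by blast
    also have "\<dots> \<le> c * (norm (B x (f x)) * norm (f x))"
      using c_pos norm_cauchy_schwarz by (intro mult_left_mono) auto
    finally have "norm (B x (f x)) * norm (B x (f x)) \<le> norm (B x (f x)) * (c * norm (f x))"
      by (simp add: power2_eq_square algebra_simps)
    then show ?case
      using c_pos by (cases "norm (B x (f x)) = 0") (auto simp: mult_le_cancel_left)
  qed
qed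

lemma form_add_left:
  assumes "f \<in> L2 \<Omega>" "g \<in> L2 \<Omega>" "h \<in> L2 \<Omega>"
  shows "form (\<lambda>x. f x + g x) h = form f h + form g h"
proof -
  have "form (\<lambda>x. f x + g x) h = l2inner \<Omega> (\<lambda>x. B x (f x) + B x (g x)) h"
    unfolding form_def by (rule l2inner_cong) (simp add: linear_add[OF lin])
  then show ?thesis using assms by (simp add: form_def l2inner_add_left apply_L2)
qed

lemma form_diff_left:
  assumes "f \<in> L2 \<Omega>" "g \<in> L2 \<Omega>" "h \<in> L2 \<Omega>"
  shows "form (\<lambda>x. f x - g x) h = form f h - form g h"
proof -
  have "form (\<lambda>x. f x - g x) h = l2inner \<Omega> (\<lambda>x. B x (f x) - B x (g x)) h"
    unfolding form_def by (rule l2inner_cong) (simp add: linear_diff[OF lin])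
  then show ?thesis using assms by (simp add: form_def l2inner_diff_left apply_L2)
qed

lemma form_scaleR_left: "form (\<lambda>x. t *\<^sub>R f x) h = t * form f h"
proof -
  have "form (\<lambda>x. t *\<^sub>R f x) h = l2inner \<Omega> (\<lambda>x. t *\<^sub>R B x (f x)) h"
    unfolding form_def by (rule l2inner_cong) (simp add: linear_cmul[OF lin])
  then show ?thesis by (simp add: form_def l2inner_scaleR_left)
qed

lemma form_add_right:
  "f \<in> L2 \<Omega> \<Longrightarrow> g \<in> L2 \<Omega> \<Longrightarrow> h \<in> L2 \<Omega> \<Longrightarrow> form f (\<lambda>x. g x + h x) = form f g + form f h"
  by (simp add: form_def l2inner_add_right apply_L2)

lemma form_diff_right:
  "f \<in> L2 \<Omega> \<Longrightarrow> g \<in> L2 \<Omega> \<Longrightarrow> h \<in> L2 \<Omega> \<Longrightarrow> form f (\<lambda>x. g x - h x) = form f g - form f h"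
  by (simp add: form_def l2inner_diff_right apply_L2)

lemma form_commute:
  assumes "f \<in> L2 \<Omega>" "g \<in> L2 \<Omega>"
  shows "form f g = form g f"
  unfolding form_def l2inner_def
proof (rule integral_cong_AE)
  show "AE x in lebesgue_on \<Omega>. B x (f x) \<bullet> g x = B x (g x) \<bullet> f x"
    using sym by eventually_elim (metis inner_commute)
qed (rule borel_measurable_integrable, intro L2_inner_integrable apply_L2 assms)+

lemma form_bound:
  assumes "f \<in> L2 \<Omega>"
  shows "(l2norm \<Omega> (\<lambda>x. B x (f x)))\<^sup>2 \<le> c * form f f"
proof -
  have "(l2norm \<Omega> (\<lambda>x. B x (f x)))\<^sup>2 = (LINT x|lebesgue_on \<Omega>. (norm (B x (f x)))\<^sup>2)"
    by (simp add: l2norm_sq l2inner_def power2_norm_eq_inner)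
  also have "\<dots> \<le> (LINT x|lebesgue_on \<Omega>. c * (B x (f x) \<bullet> f x))"
  proof (rule integral_mono_AE)
    show "integrable (lebesgue_on \<Omega>) (\<lambda>x. (norm (B x (f x)))\<^sup>2)"
      by (rule L2_integrable[OF apply_L2[OF assms]])
    show "integrable (lebesgue_on \<Omega>) (\<lambda>x. c * (B x (f x) \<bullet> f x))"
      by (intro integrable_mult_right L2_inner_integrable apply_L2 assms)
    show "AE x in lebesgue_on \<Omega>. (norm (B x (f x)))\<^sup>2 \<le> c * (B x (f x) \<bullet> f x)"
      using bound by eventually_elim blast
  qed
  finally show ?thesis by (simp add: form_def l2inner_def)
qed

lemma form_nonneg: "f \<in> L2 \<Omega> \<Longrightarrow> 0 \<le> form f f"
  using order_trans[OF zero_le_power2 form_bound[of f]] c_pos by (simp add: zero_le_mult_iff)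

text \<open>Expand the nonnegative form at \<open>f + g\<close>.\<close>

lemma form_Young:
  assumes "f \<in> L2 \<Omega>" "g \<in> L2 \<Omega>"
  shows "- form f g \<le> (form f f + form g g) / 2"
  using form_nonneg[OF L2_add[OF assms]] assms
  by (simp add: form_add_left form_add_right L2_add form_commute[of g f])

text \<open>Expand the nonnegative form at \<open>f - g\<close>. With \<open>f\<close> the new and \<open>g\<close> the old value this is the dissipation
  inequality of the implicit Euler step.\<close>

lemma form_square_difference:
  assumes "f \<in> L2 \<Omega>" "g \<in> L2 \<Omega>"
  shows "(form f f - form g g) / 2 \<le> form f f - form g f"
  using form_nonneg[OF L2_diff[OF assms]] assms
  by (simp add: form_diff_left form_diff_right L2_diff form_commute[of g f])

text \<open>Cauchy-Schwarz bounds the form by \<open>\<parallel>B f\<parallel> \<parallel>f\<parallel>\<close>, and \<open>\<parallel>B f\<parallel>\<^sup>2\<close> is bounded by the form itself.\<close>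

lemma form_le:
  assumes f: "f \<in> L2 \<Omega>"
  shows "form f f \<le> c * (l2norm \<Omega> f)\<^sup>2"
proof -
  let ?F = "l2norm \<Omega> (\<lambda>x. B x (f x))"
  have "form f f \<le> ?F * l2norm \<Omega> f"
    using l2_Cauchy_Schwarz[OF apply_L2[OF f] f] by (simp add: form_def)
  moreover have "2 * (?F * (c * l2norm \<Omega> f)) \<le> ?F\<^sup>2 + (c * l2norm \<Omega> f)\<^sup>2"
    using sum_squares_bound[of ?F "c * l2norm \<Omega> f"] by simp
  moreover have "c * form f f \<le> c * (?F * l2norm \<Omega> f)"
    by (rule mult_left_mono) (use calculation(1) c_pos in auto)
  ultimately have "2 * (c * form f f) \<le> ?F\<^sup>2 + (c * l2norm \<Omega> f)\<^sup>2" by (simp add: mult.left_commute)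
  with form_bound[OF f] have "c * form f f \<le> c * (c * (l2norm \<Omega> f)\<^sup>2)"
    by (simp add: power_mult_distrib power2_eq_square algebra_simps)
  then show ?thesis using c_pos by simp
qed

end

section \<open>The forms of the compliance and of the inverse permeability\<close>

text \<open>Almost everywhere \<open>\<bar>A\<^sup>1\<^sup>/\<^sup>2 \<sigma>\<bar>\<^sup>2 = A \<sigma> \<bullet> \<sigma>\<close>. If the left-hand side fails to be integrable, its integral is \<open>0\<close>
  by convention and the inequality still holds.\<close>

lemma op_sqrt_stress_norm_le:
  assumes \<Omega>: "open \<Omega>" "bounded \<Omega>" and A: "compliance_tensor \<Omega> A" "compliance_bounds \<Omega> \<Gamma> A a_min a_max"
    and \<sigma>: "\<sigma> \<in> stress_space \<Omega> \<Gamma>'" and cf: "coefficient_field \<Omega> A a_max"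
  shows "(l2norm \<Omega> (\<lambda>x. op_sqrt (A x) (\<sigma> x)))\<^sup>2 \<le> l2inner \<Omega> (\<lambda>x. A x (\<sigma> x)) \<sigma>"
proof -
  interpret coefficient_field \<Omega> A a_max by (rule cf)
  note L = stress_space_L2(1)[OF \<sigma>]
  let ?f = "\<lambda>x. op_sqrt (A x) (\<sigma> x)"
  have a: "0 < a_min" using A(2) by (simp add: compliance_bounds_def)
  have eq: "AE x in lebesgue_on \<Omega>. (norm (?f x))\<^sup>2 = A x (\<sigma> x) \<bullet> \<sigma> x"
    using compliance_pointwise_bounds[OF \<Omega> A]
  proof (rule lebesgue_on_mono)
    fix x assume pd: "\<forall>\<tau>. a_min * (norm \<tau>)\<^sup>2 \<le> A x \<tau> \<bullet> \<tau> \<and> A x \<tau> \<bullet> \<tau> \<le> a_max * (norm \<tau>)\<^sup>2" and "x \<in> \<Omega>"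
    show "(norm (?f x))\<^sup>2 = A x (\<sigma> x) \<bullet> \<sigma> x"
    proof (rule norm_op_sqrt)
      show "linear (A x)" by (rule lin[OF \<open>x \<in> \<Omega>\<close>])
      show "A x v \<bullet> w = v \<bullet> A x w" for v w
        using A(1) \<open>x \<in> \<Omega>\<close> unfolding compliance_tensor_def by blast
      have "0 \<le> a_min * (norm v)\<^sup>2" for v :: "real^'a^'a" using a by simp
      then show "0 \<le> A x v \<bullet> v" for v using pd order_trans by blast
    qed
  qed
  have "l2inner \<Omega> ?f ?f \<le> l2inner \<Omega> (\<lambda>x. A x (\<sigma> x)) \<sigma>"
  proof (cases "integrable (lebesgue_on \<Omega>) (\<lambda>x. ?f x \<bullet> ?f x)")
    case True
    then show ?thesis
      unfolding l2inner_def
      by (rule integral_mono_AE[OF _ L2_inner_integrable[OF apply_L2[OF L] L]])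
        (use eq in \<open>auto simp: power2_norm_eq_inner elim: AE_mp\<close>)
  next
    case False
    then show ?thesis
      using form_nonneg[OF L] by (simp add: l2inner_def not_integrable_integral_eq form_def)
  qed
  then show ?thesis by (simp add: l2norm_sq)
qed

lemma compliance_coefficient_field:
  assumes \<Omega>: "open \<Omega>" "bounded \<Omega>" and A: "compliance_tensor \<Omega> A" "compliance_bounds \<Omega> \<Gamma> A a_min a_max"
  shows "coefficient_field \<Omega> A a_max"
proof (rule coefficient_field.intro)
  have a: "0 < a_min" "0 < a_max" using A(2) by (auto simp: compliance_bounds_def)
  show "(\<lambda>x. A x v) \<in> borel_measurable (lebesgue_on \<Omega>)" for v
    using A(1) by (simp add: compliance_tensor_def)
  show lin: "linear (A x)" if "x \<in> \<Omega>" for x using A(1) that by (simp add: compliance_tensor_def)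
  have sym: "A x v \<bullet> w = v \<bullet> A x w" if "x \<in> \<Omega>" for x v w
    using A(1) that unfolding compliance_tensor_def by blast
  show "AE x in lebesgue_on \<Omega>. \<forall>v w. A x v \<bullet> w = v \<bullet> A x w"
    by (rule lebesgue_on_mono[of "\<lambda>_. True"]) (auto intro: sym)
  show "AE x in lebesgue_on \<Omega>. \<forall>v. (norm (A x v))\<^sup>2 \<le> a_max * (A x v \<bullet> v)"
    using compliance_pointwise_bounds[OF \<Omega> A]
  proof (rule lebesgue_on_mono, intro allI)
    fix x v
    assume pd: "\<forall>\<tau>. a_min * (norm \<tau>)\<^sup>2 \<le> A x \<tau> \<bullet> \<tau> \<and> A x \<tau> \<bullet> \<tau> \<le> a_max * (norm \<tau>)\<^sup>2" and "x \<in> \<Omega>"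
    show "(norm (A x v))\<^sup>2 \<le> a_max * (A x v \<bullet> v)"
    proof (rule norm_sq_le_quadratic_form[OF lin[OF \<open>x \<in> \<Omega>\<close>] sym[OF \<open>x \<in> \<Omega>\<close>]])
      have "0 \<le> a_min * (norm v)\<^sup>2" for v :: "real^'a^'a" using a by simp
      then show "0 \<le> A x v \<bullet> v" for v using pd order_trans by blast
      show "A x v \<bullet> v \<le> a_max * (norm v)\<^sup>2" for v using pd by blast
    qed (rule a)
  qed
  show "0 < a_max" by (rule a)
qed

text \<open>The bounds of \<open>K\<close> at almost every point, inverted. The second part is the lower bound of the form of
  \<open>K\<inverse>\<close>, which recovers the flux norm from the energy.\<close>

lemma inverse_permeability:
  fixes \<Omega> :: "(real^'d) set"
  assumes \<Omega>: "open \<Omega>" "bounded \<Omega>" and K: "permeability_tensor \<Omega> K" "permeability_bounds \<Omega> \<Gamma> K k_min k_max"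
  shows "coefficient_field \<Omega> (\<lambda>x v. matrix_inv (K x) *v v) (1 / k_min)"
    "z \<in> L2 \<Omega> \<Longrightarrow> (l2norm \<Omega> z)\<^sup>2 \<le> k_max * coefficient_field.form \<Omega> (\<lambda>x v. matrix_inv (K x) *v v) z z"
proof -
  have k: "0 < k_min" "0 < k_max" using K(2) by (auto simp: permeability_bounds_def)
  have pd: "AE x in lebesgue_on \<Omega>. transpose (K x) = K x \<and>
    (\<forall>v. k_min * (norm v)\<^sup>2 \<le> (K x *v v) \<bullet> v \<and> (K x *v v) \<bullet> v \<le> k_max * (norm v)\<^sup>2)"
    by (rule lebesgue_on_mono[OF permeability_pointwise_bounds[OF \<Omega> K]])
      (use K(1) in \<open>simp add: permeability_tensor_def\<close>)
  have facts: "AE x in lebesgue_on \<Omega>. det (K x) \<noteq> 0 \<and> (\<forall>v. K x *v (matrix_inv (K x) *v v) = v \<and>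
      (\<forall>w. (matrix_inv (K x) *v v) \<bullet> w = v \<bullet> (matrix_inv (K x) *v w)) \<and>
      (norm (matrix_inv (K x) *v v))\<^sup>2 \<le> (1 / k_min) * ((matrix_inv (K x) *v v) \<bullet> v) \<and>
      (norm v)\<^sup>2 \<le> k_max * ((matrix_inv (K x) *v v) \<bullet> v))"
    using pd
  proof eventually_elim
    case (elim x)
    then have "transpose (K x) = K x" "\<And>v. k_min * (norm v)\<^sup>2 \<le> (K x *v v) \<bullet> v"
      "\<And>v. (K x *v v) \<bullet> v \<le> k_max * (norm v)\<^sup>2" by auto
    note pos_def_matrix_inv[OF this k]
    then show ?case by blast
  qed
  show cf: "coefficient_field \<Omega> (\<lambda>x v. matrix_inv (K x) *v v) (1 / k_min)"
  proof (rule coefficient_field.intro)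
    show "(\<lambda>x. matrix_inv (K x) *v v) \<in> borel_measurable (lebesgue_on \<Omega>)" for v
    proof (rule borel_measurable_matrix_inv_mult)
      show "\<Omega> \<in> sets lebesgue" using \<Omega>(1) by auto
      show "K \<in> borel_measurable (lebesgue_on \<Omega>)" using K(1) by (simp add: permeability_tensor_def)
      show "AE x in lebesgue_on \<Omega>. det (K x) \<noteq> 0 \<and> K x *v (matrix_inv (K x) *v v) = v"
        using facts by eventually_elim blast
    qed
    show "linear (\<lambda>v. matrix_inv (K x) *v v)" for x by (rule matrix_vector_mul_linear)
    show "AE x in lebesgue_on \<Omega>. \<forall>v w. (matrix_inv (K x) *v v) \<bullet> w = v \<bullet> (matrix_inv (K x) *v w)"
      using facts by eventually_elim blast
    show "AE x in lebesgue_on \<Omega>. \<forall>v. (norm (matrix_inv (K x) *v v))\<^sup>2 \<le> (1 / k_min) * ((matrix_inv (K x) *v v) \<bullet> v)"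
      using facts by eventually_elim blast
    show "0 < 1 / k_min" using k by simp
  qed
  interpret coefficient_field \<Omega> "\<lambda>x v. matrix_inv (K x) *v v" "1 / k_min" by (rule cf)
  show "(l2norm \<Omega> z)\<^sup>2 \<le> k_max * form z z" if z: "z \<in> L2 \<Omega>"
  proof -
    have "(l2norm \<Omega> z)\<^sup>2 = (LINT x|lebesgue_on \<Omega>. (norm (z x))\<^sup>2)"
      by (simp add: l2norm_sq l2inner_def power2_norm_eq_inner)
    also have "\<dots> \<le> (LINT x|lebesgue_on \<Omega>. k_max * ((matrix_inv (K x) *v z x) \<bullet> z x))"
    proof (rule integral_mono_AE[OF L2_integrable[OF z]])
      show "integrable (lebesgue_on \<Omega>) (\<lambda>x. k_max * ((matrix_inv (K x) *v z x) \<bullet> z x))"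
        by (intro integrable_mult_right L2_inner_integrable apply_L2 z)
      show "AE x in lebesgue_on \<Omega>. (norm (z x))\<^sup>2 \<le> k_max * ((matrix_inv (K x) *v z x) \<bullet> z x)"
        using facts by eventually_elim blast
    qed
    finally show ?thesis by (simp add: form_def l2inner_def)
  qed
qed

section \<open>The energy estimate\<close>

text \<open>This covers the empty supremum \<open>-\<infinity>\<close> as well, which occurs when the space has no element of
  nonzero norm.\<close>

lemma bound_of_scaled_SUP:
  fixes f :: "'i \<Rightarrow> real"
  assumes "ereal x \<le> ereal C * (SUP i\<in>I. ereal (f i))" "0 \<le> C" "\<And>i. i \<in> I \<Longrightarrow> f i \<le> b"
  shows "x \<le> C * b"
proof -
  have "(SUP i\<in>I. ereal (f i)) \<le> ereal b" using assms(3) by (intro SUP_least) simp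
  then have "ereal C * (SUP i\<in>I. ereal (f i)) \<le> ereal C * ereal b"
    using assms(2) by (intro ereal_mult_left_mono) auto
  then have "ereal x \<le> ereal C * ereal b" by (rule order_trans[OF assms(1)])
  then show ?thesis by simp
qed

text \<open>One mesh of the family. The bounds of the permeability are restated for the form of \<open>K\<inverse>\<close>:
  \<open>1 / k_min\<close> bounds it from above, and by the last assumption \<open>1 / k_max\<close> bounds it from below.\<close>

locale biot_discretization =
  A: coefficient_field \<Omega> A a_max + Kinv: coefficient_field \<Omega> "\<lambda>x v. matrix_inv (K x) *v v" "1 / k_min"
  for \<Omega> :: "(real^'d) set" and A :: "real^'d \<Rightarrow> real^'d^'d \<Rightarrow> real^'d^'d" and a_max :: real
    and K :: "real^'d \<Rightarrow> real^'d^'d" and k_min :: real +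
  fixes \<Gamma>N\<sigma> \<Gamma>Nz :: "(real^'d) set" and \<alpha> C_el C_d k_max :: real
    and Xh :: "(real^'d \<Rightarrow> real^'d^'d) set" and Vh :: "(real^'d \<Rightarrow> real^'d) set"
    and Qh :: "(real^'d \<Rightarrow> real^'d^'d) set" and Zh :: "(real^'d \<Rightarrow> real^'d) set"
    and Wh :: "(real^'d \<Rightarrow> real) set"
  assumes Xh: "Xh \<subseteq> stress_space \<Omega> \<Gamma>N\<sigma>" and Vh: "Vh \<subseteq> L2 \<Omega>" and Qh: "Qh \<subseteq> L2 \<Omega>"
    and Zh: "Zh \<subseteq> velocity_space \<Omega> \<Gamma>Nz" and Wh: "Wh \<subseteq> L2 \<Omega>"
    and Wh_diff: "\<And>p q. p \<in> Wh \<Longrightarrow> q \<in> Wh \<Longrightarrow> (\<lambda>x. p x - q x) \<in> Wh"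
    and alpha: "0 < \<alpha>" "\<alpha> \<le> 1"
    and C_el: "0 < C_el" "infsup_elasticity \<Omega> C_el Xh Vh Qh"
    and C_d: "0 < C_d" "infsup_darcy \<Omega> C_d Zh Wh"
    and k_max: "\<And>z. z \<in> L2 \<Omega> \<Longrightarrow> (l2norm \<Omega> z)\<^sup>2 \<le> k_max * Kinv.form z z"
begin

lemma XhD: "\<tau> \<in> Xh \<Longrightarrow> \<tau> \<in> L2 \<Omega>" "\<tau> \<in> Xh \<Longrightarrow> wdiv_mat \<Omega> \<tau> \<in> L2 \<Omega>"
  using Xh stress_space_L2 by blast+

lemma ZhD: "q \<in> Zh \<Longrightarrow> q \<in> L2 \<Omega>" "q \<in> Zh \<Longrightarrow> wdiv \<Omega> q \<in> L2 \<Omega>"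
  using Zh velocity_space_L2 by blast+

text \<open>The contribution \<open>\<alpha> p I\<close> of the pore pressure to the stress.\<close>

definition pressure_stress :: "(real^'d \<Rightarrow> real) \<Rightarrow> real^'d \<Rightarrow> real^'d^'d" where
  "pressure_stress p = (\<lambda>x. (\<alpha> * p x) *\<^sub>R mat 1)"

lemma norm_mat_1: "(norm (mat 1 :: real^'d^'d))\<^sup>2 = CARD('d)"
proof -
  have "(norm (mat 1 :: real^'d^'d))\<^sup>2 = (\<Sum>i\<in>UNIV. \<Sum>j\<in>UNIV. (mat 1 :: real^'d^'d) $ i $ j * (mat 1 :: real^'d^'d) $ i $ j)"
    by (simp add: power2_norm_eq_inner inner_vec_def)
  also have "\<dots> = (\<Sum>i\<in>(UNIV::'d set). \<Sum>j\<in>(UNIV::'d set). if i = j then 1 else 0)"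
    by (intro sum.cong refl) (simp add: mat_def)
  finally show ?thesis by simp
qed

lemma pressure_stress_L2: "p \<in> L2 \<Omega> \<Longrightarrow> pressure_stress p \<in> L2 \<Omega>"
  unfolding pressure_stress_def
  by (rule L2_dominated[where c="\<alpha> * norm (mat 1 :: real^'d^'d)"])
    (use alpha(1) in \<open>auto intro!: borel_measurable_scaleR borel_measurable_times dest: L2_measurable simp: abs_mult\<close>)

lemma form_pressure_stress_le:
  assumes "p \<in> L2 \<Omega>"
  shows "A.form (pressure_stress p) (pressure_stress p) \<le> a_max * CARD('d) * (l2norm \<Omega> p)\<^sup>2"
proof -
  have "(l2norm \<Omega> (pressure_stress p))\<^sup>2 = \<alpha>\<^sup>2 * CARD('d) * (l2norm \<Omega> p)\<^sup>2"
  proof -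
    have "(l2norm \<Omega> (pressure_stress p))\<^sup>2 = l2inner \<Omega> (\<lambda>x. (\<alpha>\<^sup>2 * CARD('d)) *\<^sub>R p x) p"
      unfolding l2norm_sq
      by (rule l2inner_cong)
        (simp add: pressure_stress_def norm_mat_1[unfolded power2_norm_eq_inner] power2_eq_square)
    then show ?thesis by (simp only: l2inner_scaleR_left l2norm_sq)
  qed
  also have "\<dots> \<le> 1 * CARD('d) * (l2norm \<Omega> p)\<^sup>2"
    using alpha by (intro mult_right_mono) (auto simp: power_le_one)
  finally have "a_max * (l2norm \<Omega> (pressure_stress p))\<^sup>2 \<le> a_max * (1 * CARD('d) * (l2norm \<Omega> p)\<^sup>2)"
    using A.c_pos by (intro mult_left_mono) auto
  with A.form_le[OF pressure_stress_L2[OF assms]] show ?thesis by simp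
qed

definition stationary ::
  "(real^'d \<Rightarrow> real^'d^'d) \<Rightarrow> (real^'d \<Rightarrow> real^'d) \<Rightarrow> (real^'d \<Rightarrow> real^'d^'d) \<Rightarrow>
   (real^'d \<Rightarrow> real^'d) \<Rightarrow> (real^'d \<Rightarrow> real) \<Rightarrow> bool" where
  "stationary \<sigma> u \<gamma> z p \<longleftrightarrow> \<sigma> \<in> Xh \<and> u \<in> Vh \<and> \<gamma> \<in> Qh \<and> z \<in> Zh \<and> p \<in> Wh \<and>
     stationary_equations \<Omega> K A \<alpha> Xh Vh Qh Zh \<sigma> u \<gamma> z p"

lemma stationaryD:
  assumes "stationary \<sigma> u \<gamma> z p"
  shows "\<sigma> \<in> L2 \<Omega>" "u \<in> L2 \<Omega>" "\<gamma> \<in> L2 \<Omega>" "z \<in> L2 \<Omega>" "p \<in> L2 \<Omega>" "pressure_stress p \<in> L2 \<Omega>"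
  using assms Vh Qh Wh XhD ZhD pressure_stress_L2 by (auto simp: stationary_def)

lemma darcy:
  assumes "stationary \<sigma> u \<gamma> z p" "q \<in> Zh"
  shows "Kinv.form z q = l2inner \<Omega> p (wdiv \<Omega> q)"
  using assms by (simp add: stationary_def stationary_equations_def Kinv.form_def)

text \<open>The two terms with \<open>A\<close> are merged, because both inf-sup stability and the energy identities see only the
  sum \<open>\<sigma> + \<alpha> p I\<close>.\<close>

lemma elasticity:
  assumes "stationary \<sigma> u \<gamma> z p" "\<tau> \<in> Xh"
  shows "l2inner \<Omega> u (wdiv_mat \<Omega> \<tau>) + l2inner \<Omega> \<gamma> \<tau> = - A.form (\<lambda>x. \<sigma> x + pressure_stress p x) \<tau>"
proof -
  have "A.form \<sigma> \<tau> + l2inner \<Omega> u (wdiv_mat \<Omega> \<tau>) + l2inner \<Omega> \<gamma> \<tau> = - A.form (pressure_stress p) \<tau>"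
    using assms by (simp add: stationary_def stationary_equations_def A.form_def pressure_stress_def)
  then show ?thesis
    using assms stationaryD[OF assms(1)] XhD by (simp add: A.form_add_left)
qed

text \<open>The stress of either solution is orthogonal to the rotation of the other, and its divergence to the
  displacement. Stating the identity
  for two different solutions lets bilinearity produce the one for their difference, with the weak
  divergence applied to single stresses only.\<close>

lemma stress_cross_identity:
  assumes 1: "stationary \<sigma>1 u1 \<gamma>1 z1 p1" and 2: "stationary \<sigma>2 u2 \<gamma>2 z2 p2"
  shows "A.form \<sigma>1 \<sigma>2 = - A.form (pressure_stress p1) \<sigma>2"
proof -
  have "l2inner \<Omega> (wdiv_mat \<Omega> \<sigma>2) u1 = 0" "l2inner \<Omega> \<sigma>2 \<gamma>1 = 0"
    using 1 2 by (auto simp: stationary_def stationary_equations_def)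
  then have "A.form (\<lambda>x. \<sigma>1 x + pressure_stress p1 x) \<sigma>2 = 0"
    using elasticity[OF 1, of \<sigma>2] 2 by (simp add: stationary_def l2inner_commute[of \<Omega> u1] l2inner_commute[of \<Omega> \<gamma>1])
  then show ?thesis
    using stationaryD[OF 1] stationaryD[OF 2] by (simp add: A.form_add_left)
qed

text \<open>From \<open>(A S, S) = - (A P, S)\<close> by Young's inequality. The constant \<open>1\<close> is what makes the lagged coupling term
  absorbable in every time step.\<close>

lemma stress_increment_le:
  assumes 1: "stationary \<sigma>1 u1 \<gamma>1 z1 p1" and 2: "stationary \<sigma>2 u2 \<gamma>2 z2 p2"
  shows "A.form (\<lambda>x. \<sigma>1 x - \<sigma>2 x) (\<lambda>x. \<sigma>1 x - \<sigma>2 x)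
    \<le> A.form (pressure_stress (\<lambda>x. p1 x - p2 x)) (pressure_stress (\<lambda>x. p1 x - p2 x))"
proof -
  note L = stationaryD[OF 1] stationaryD[OF 2]
  let ?S = "\<lambda>x. \<sigma>1 x - \<sigma>2 x" and ?P = "\<lambda>x. pressure_stress p1 x - pressure_stress p2 x"
  have P: "pressure_stress (\<lambda>x. p1 x - p2 x) = ?P"
    by (simp add: pressure_stress_def algebra_simps)
  have "A.form ?S ?S = - A.form ?P ?S"
    using L stress_cross_identity[OF 1 1] stress_cross_identity[OF 1 2]
      stress_cross_identity[OF 2 1] stress_cross_identity[OF 2 2]
    by (simp add: A.form_diff_left A.form_diff_right L2_diff)
  also have "\<dots> \<le> (A.form ?P ?P + A.form ?S ?S) / 2"
    using L by (intro A.form_Young L2_diff)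
  finally show ?thesis unfolding P by simp
qed

lemma stress_le_pressure_stress:
  assumes "stationary \<sigma> u \<gamma> z p"
  shows "A.form \<sigma> \<sigma> \<le> A.form (pressure_stress p) (pressure_stress p)"
  using stress_cross_identity[OF assms assms] A.form_Young[of "pressure_stress p" \<sigma>] stationaryD[OF assms]
  by simp

text \<open>By the Darcy equation the functional in the inf-sup condition is \<open>(K\<inverse> z, q)\<close>.\<close>

lemma pressure_le:
  assumes s: "stationary \<sigma> u \<gamma> z p"
  shows "(l2norm \<Omega> p)\<^sup>2 \<le> C_d\<^sup>2 / k_min * Kinv.form z z"
proof -
  let ?F = "l2norm \<Omega> (\<lambda>x. matrix_inv (K x) *v z x)"
  have "l2norm \<Omega> p \<le> C_d * ?F"
  proof (rule bound_of_scaled_SUP)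
    show "ereal (l2norm \<Omega> p) \<le> ereal C_d * (SUP q\<in>{q \<in> Zh. hdiv_norm \<Omega> q \<noteq> 0}.
        ereal (l2inner \<Omega> (wdiv \<Omega> q) p / hdiv_norm \<Omega> q))"
      using C_d(2) s by (auto simp: infsup_darcy_def stationary_def)
    fix q assume q: "q \<in> {q \<in> Zh. hdiv_norm \<Omega> q \<noteq> 0}"
    then have pos: "0 < hdiv_norm \<Omega> q" using l2norm_le_hdiv_norm(1)[of \<Omega> q] l2norm_nonneg[of \<Omega> q] by auto
    have "l2inner \<Omega> (wdiv \<Omega> q) p = Kinv.form z q"
      using darcy[OF s, of q] q by (simp add: l2inner_commute)
    also have "\<dots> \<le> ?F * l2norm \<Omega> q"
      using l2_Cauchy_Schwarz[OF Kinv.apply_L2[OF stationaryD(4)[OF s]] ZhD(1), of q] q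
      by (simp add: Kinv.form_def)
    also have "\<dots> \<le> ?F * hdiv_norm \<Omega> q"
      by (intro mult_left_mono l2norm_le_hdiv_norm l2norm_nonneg)
    finally show "l2inner \<Omega> (wdiv \<Omega> q) p / hdiv_norm \<Omega> q \<le> ?F" using pos by (simp add: pos_divide_le_eq)
  qed (use C_d in simp)
  then have "(l2norm \<Omega> p)\<^sup>2 \<le> (C_d * ?F)\<^sup>2" by (intro power_mono l2norm_nonneg)
  also have "\<dots> \<le> C_d\<^sup>2 * (1 / k_min * Kinv.form z z)"
    unfolding power_mult_distrib
    by (intro mult_left_mono Kinv.form_bound stationaryD[OF s]) simp
  finally show ?thesis by simp
qed

text \<open>By the elasticity equation the functional in the inf-sup condition is \<open>- (A (\<sigma> + \<alpha> p I), \<tau>)\<close>. Passing from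
  \<open>\<parallel>A e\<parallel>\<^sup>2\<close> to \<open>a_max (A e, e)\<close> keeps the constant free of the lower bound of \<open>A\<close>.\<close>

lemma displacement_rotation_le:
  assumes s: "stationary \<sigma> u \<gamma> z p"
  shows "(l2norm \<Omega> u)\<^sup>2 + (l2norm \<Omega> \<gamma>)\<^sup>2 \<le> 4 * C_el\<^sup>2 * a_max * A.form (pressure_stress p) (pressure_stress p)"
proof -
  note L = stationaryD[OF s]
  let ?P = "pressure_stress p"
  let ?E = "\<lambda>x. \<sigma> x + ?P x"
  let ?F = "l2norm \<Omega> (\<lambda>x. A x (?E x))"
  have E: "?E \<in> L2 \<Omega>" using L by (intro L2_add)
  have "l2norm \<Omega> u + l2norm \<Omega> \<gamma> \<le> C_el * ?F"
  proof (rule bound_of_scaled_SUP)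
    show "ereal (l2norm \<Omega> u + l2norm \<Omega> \<gamma>) \<le> ereal C_el * (SUP \<tau>\<in>{\<tau> \<in> Xh. hdiv_norm_mat \<Omega> \<tau> \<noteq> 0}.
        ereal ((l2inner \<Omega> u (wdiv_mat \<Omega> \<tau>) + l2inner \<Omega> \<gamma> \<tau>) / hdiv_norm_mat \<Omega> \<tau>))"
      using C_el(2) s unfolding infsup_elasticity_def stationary_def by blast
    fix \<tau> assume \<tau>: "\<tau> \<in> {\<tau> \<in> Xh. hdiv_norm_mat \<Omega> \<tau> \<noteq> 0}"
    then have pos: "0 < hdiv_norm_mat \<Omega> \<tau>"
      using l2norm_le_hdiv_norm(2)[of \<Omega> \<tau>] l2norm_nonneg[of \<Omega> \<tau>] by auto
    have "l2inner \<Omega> u (wdiv_mat \<Omega> \<tau>) + l2inner \<Omega> \<gamma> \<tau> = - A.form ?E \<tau>"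
      using elasticity[OF s, of \<tau>] \<tau> by simp
    also have "\<dots> \<le> ?F * l2norm \<Omega> \<tau>"
      using l2_Cauchy_Schwarz[OF A.apply_L2[OF E] XhD(1), of \<tau>] \<tau> by (simp add: A.form_def)
    also have "\<dots> \<le> ?F * hdiv_norm_mat \<Omega> \<tau>"
      by (intro mult_left_mono l2norm_le_hdiv_norm l2norm_nonneg)
    finally show "(l2inner \<Omega> u (wdiv_mat \<Omega> \<tau>) + l2inner \<Omega> \<gamma> \<tau>) / hdiv_norm_mat \<Omega> \<tau> \<le> ?F"
      using pos by (simp add: pos_divide_le_eq)
  qed (use C_el in simp)
  then have "(l2norm \<Omega> u + l2norm \<Omega> \<gamma>)\<^sup>2 \<le> (C_el * ?F)\<^sup>2"
    by (intro power_mono add_nonneg_nonneg l2norm_nonneg)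
  also have "\<dots> = C_el\<^sup>2 * ?F\<^sup>2" by (simp add: power_mult_distrib)
  also have "?F\<^sup>2 \<le> a_max * A.form ?E ?E" by (rule A.form_bound[OF E])
  also have "A.form ?E ?E \<le> 4 * A.form ?P ?P"
  proof -
    have "A.form ?E ?E = A.form \<sigma> \<sigma> + 2 * A.form ?P \<sigma> + A.form ?P ?P"
      using L by (simp add: A.form_add_left A.form_add_right L2_add A.form_commute[of \<sigma> ?P])
    also have "A.form ?P \<sigma> = - A.form \<sigma> \<sigma>" using stress_cross_identity[OF s s] by simp
    finally show ?thesis
      using A.form_nonneg[OF L(1)] A.form_nonneg[OF L(6)] by simp
  qed
  finally have "(l2norm \<Omega> u + l2norm \<Omega> \<gamma>)\<^sup>2 \<le> C_el\<^sup>2 * (a_max * (4 * A.form ?P ?P))"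
    using A.c_pos by (simp add: mult_left_mono)
  moreover have "(l2norm \<Omega> u)\<^sup>2 + (l2norm \<Omega> \<gamma>)\<^sup>2 \<le> (l2norm \<Omega> u + l2norm \<Omega> \<gamma>)\<^sup>2"
    using mult_nonneg_nonneg[OF l2norm_nonneg l2norm_nonneg, of \<Omega> u \<Omega> \<gamma>] by (simp add: power2_sum)
  ultimately show ?thesis by (simp add: algebra_simps)
qed

lemma stationary_bound:
  assumes s: "stationary \<sigma> u \<gamma> z p"
  defines "D \<equiv> C_d\<^sup>2 / k_min"
  shows "(l2norm \<Omega> z)\<^sup>2 + (l2norm \<Omega> p)\<^sup>2 + A.form \<sigma> \<sigma> + (l2norm \<Omega> u)\<^sup>2 + (l2norm \<Omega> \<gamma>)\<^sup>2
    \<le> (k_max + D + (1 + 4 * C_el\<^sup>2 * a_max) * (a_max * CARD('d) * D)) * Kinv.form z z"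
proof -
  note L = stationaryD[OF s]
  let ?P = "A.form (pressure_stress p) (pressure_stress p)"
  have p: "(l2norm \<Omega> p)\<^sup>2 \<le> D * Kinv.form z z" unfolding D_def by (rule pressure_le[OF s])
  have "?P \<le> a_max * CARD('d) * (l2norm \<Omega> p)\<^sup>2" by (rule form_pressure_stress_le[OF L(5)])
  also have "\<dots> \<le> a_max * CARD('d) * (D * Kinv.form z z)"
    using p A.c_pos by (intro mult_left_mono) auto
  finally have P: "?P \<le> a_max * CARD('d) * D * Kinv.form z z" by simp
  have "(1 + 4 * C_el\<^sup>2 * a_max) * ?P \<le> (1 + 4 * C_el\<^sup>2 * a_max) * (a_max * CARD('d) * D * Kinv.form z z)"
    using P A.c_pos by (intro mult_left_mono) auto
  then have "A.form \<sigma> \<sigma> + ((l2norm \<Omega> u)\<^sup>2 + (l2norm \<Omega> \<gamma>)\<^sup>2)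
      \<le> (1 + 4 * C_el\<^sup>2 * a_max) * (a_max * CARD('d) * D * Kinv.form z z)"
    using stress_le_pressure_stress[OF s] displacement_rotation_le[OF s] by (simp add: distrib_right)
  with p k_max[OF L(4)] show ?thesis by (simp add: algebra_simps)
qed

text \<open>The pressure equation tested with the pressure increment. Half of the pressure term absorbs the lagged stress
  increment; the other half dominates the new stress increment by \<open>stress_increment_le\<close>.\<close>

lemma energy_step:
  assumes s0: "stationary \<sigma>0 u0 \<gamma>0 z0 p0" and s1: "stationary \<sigma>1 u1 \<gamma>1 z1 p1"
    and \<sigma>m: "\<sigma>m \<in> L2 \<Omega>" and dt: "0 < dt"
    and eq: "pressure_equation \<Omega> A \<alpha> c0 dt Wh \<sigma>m \<sigma>0 p0 z1 p1"
  shows "c0 / dt * (l2norm \<Omega> (\<lambda>x. p1 x - p0 x))\<^sup>2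
      + A.form (\<lambda>x. \<sigma>1 x - \<sigma>0 x) (\<lambda>x. \<sigma>1 x - \<sigma>0 x) / (2 * dt) + Kinv.form z1 z1 / 2
    \<le> A.form (\<lambda>x. \<sigma>0 x - \<sigma>m x) (\<lambda>x. \<sigma>0 x - \<sigma>m x) / (2 * dt) + Kinv.form z0 z0 / 2"
proof -
  note L = stationaryD[OF s0] stationaryD[OF s1]
  let ?w = "\<lambda>x. p1 x - p0 x"
  let ?P = "pressure_stress ?w"
  let ?S = "\<lambda>x. \<sigma>0 x - \<sigma>m x"
  have w: "?w \<in> Wh" "?w \<in> L2 \<Omega>" using s0 s1 Wh_diff Wh by (auto simp: stationary_def)
  have P: "?P \<in> L2 \<Omega>" and S: "?S \<in> L2 \<Omega>"
    using pressure_stress_L2[OF w(2)] L2_diff L \<sigma>m by auto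
  have \<alpha>I: "\<alpha> * l2inner \<Omega> f (\<lambda>x. ?w x *\<^sub>R mat 1) = l2inner \<Omega> f ?P" for f
    unfolding pressure_stress_def scaleR_scaleR[symmetric] l2inner_scaleR_right ..
  have dtw: "(1 / dt) *\<^sub>R ?P x = (\<alpha> * (?w x / dt)) *\<^sub>R mat 1" for x
    by (simp add: pressure_stress_def)
  have "c0 * l2inner \<Omega> (\<lambda>x. (1 / dt) *\<^sub>R ?w x) ?w
      + l2inner \<Omega> (\<lambda>x. A x ((1 / dt) *\<^sub>R ?P x)) ?P + l2inner \<Omega> (wdiv \<Omega> z1) ?w
      = - l2inner \<Omega> (\<lambda>x. A x ((1 / dt) *\<^sub>R ?S x)) ?P"
    using eq[unfolded pressure_equation_def, rule_format, OF w(1)]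
    unfolding dtw \<alpha>I[symmetric] by simp
  then have bal: "c0 / dt * (l2norm \<Omega> ?w)\<^sup>2 + A.form ?P ?P / dt + l2inner \<Omega> (wdiv \<Omega> z1) ?w = - A.form ?S ?P / dt"
    unfolding A.form_def[symmetric] A.form_scaleR_left l2inner_scaleR_left l2norm_sq by simp
  have "z1 \<in> Zh" using s1 by (simp add: stationary_def)
  then have "l2inner \<Omega> (wdiv \<Omega> z1) ?w = Kinv.form z1 z1 - Kinv.form z0 z1"
    using L ZhD(2)[of z1]
    by (simp add: darcy[OF s0] darcy[OF s1] l2inner_diff_right l2inner_commute[of \<Omega> _ "wdiv \<Omega> z1"])
  then have K: "Kinv.form z1 z1 / 2 - Kinv.form z0 z0 / 2 \<le> l2inner \<Omega> (wdiv \<Omega> z1) ?w"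
    using Kinv.form_square_difference[of z1 z0] L by (simp add: diff_divide_distrib)
  have "- A.form ?S ?P / dt \<le> (A.form ?S ?S + A.form ?P ?P) / 2 / dt"
    using A.form_Young[OF S P] dt by (intro divide_right_mono) auto
  also have "\<dots> = A.form ?S ?S / (2 * dt) + A.form ?P ?P / (2 * dt)" by (simp add: add_divide_distrib)
  finally have Y: "- A.form ?S ?P / dt \<le> A.form ?S ?S / (2 * dt) + A.form ?P ?P / (2 * dt)" .
  have I: "A.form (\<lambda>x. \<sigma>1 x - \<sigma>0 x) (\<lambda>x. \<sigma>1 x - \<sigma>0 x) / (2 * dt) \<le> A.form ?P ?P / (2 * dt)"
    using stress_increment_le[OF s1 s0] dt by (intro divide_right_mono) auto
  have "A.form ?P ?P / dt = A.form ?P ?P / (2 * dt) + A.form ?P ?P / (2 * dt)" using dt by (simp add: field_simps)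
  with bal K Y I show ?thesis by linarith
qed

text \<open>At level \<open>0\<close> the lagged stress increment is zero, since \<open>\<sigma>\<^bsub>-1\<^esub> = \<sigma>\<^bsub>0\<^esub>\<close>; from there \<open>energy_step\<close>
  telescopes.\<close>

lemma energy_estimate:
  assumes sol: "fixed_stress_solution \<Omega> K A \<alpha> c0 dt N Xh Vh Qh Zh Wh \<sigma> u \<gamma> z p" and dt: "0 < dt"
    and "m \<le> N"
  defines "S \<equiv> \<lambda>n x. \<sigma> n x - (if n = 0 then \<sigma> 0 else \<sigma> (n - 1)) x"
  shows "(\<Sum>n<m. c0 / dt * (l2norm \<Omega> (\<lambda>x. p (n + 1) x - p n x))\<^sup>2)
    + A.form (S m) (S m) / (2 * dt) + Kinv.form (z m) (z m) / 2 \<le> Kinv.form (z 0) (z 0) / 2"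
  using \<open>m \<le> N\<close>
proof (induction m)
  case 0
  have "\<sigma> 0 \<in> L2 \<Omega>" using sol XhD by (auto simp: fixed_stress_solution_def)
  then show ?case by (simp add: S_def A.form_diff_left[of "\<sigma> 0" "\<sigma> 0", simplified] A.form_def l2inner_def)
next
  case (Suc m)
  have stat: "stationary (\<sigma> n) (u n) (\<gamma> n) (z n) (p n)" if "n \<le> N" for n
    using sol that unfolding fixed_stress_solution_def stationary_def by blast
  have \<sigma>m: "(if m = 0 then \<sigma> 0 else \<sigma> (m - 1)) \<in> L2 \<Omega>"
    using stationaryD(1)[OF stat] Suc.prems by auto
  have "pressure_equation \<Omega> A \<alpha> c0 dt Wh (if m = 0 then \<sigma> 0 else \<sigma> (m - 1)) (\<sigma> m) (p m) (z (m + 1)) (p (m + 1))"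
    using sol Suc.prems unfolding fixed_stress_solution_def by simp
  then have "c0 / dt * (l2norm \<Omega> (\<lambda>x. p (m + 1) x - p m x))\<^sup>2
      + A.form (S (m + 1)) (S (m + 1)) / (2 * dt) + Kinv.form (z (m + 1)) (z (m + 1)) / 2
      \<le> A.form (S m) (S m) / (2 * dt) + Kinv.form (z m) (z m) / 2"
    using energy_step[OF stat[of m] stat[of "m + 1"] \<sigma>m dt] Suc.prems by (simp add: S_def)
  moreover have "(\<Sum>n<m. c0 / dt * (l2norm \<Omega> (\<lambda>x. p (n + 1) x - p n x))\<^sup>2)
    + A.form (S m) (S m) / (2 * dt) + Kinv.form (z m) (z m) / 2 \<le> Kinv.form (z 0) (z 0) / 2"
    using Suc by simp
  ultimately have "(\<Sum>n<Suc m. c0 / dt * (l2norm \<Omega> (\<lambda>x. p (n + 1) x - p n x))\<^sup>2)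
    + A.form (S (m + 1)) (S (m + 1)) / (2 * dt) + Kinv.form (z (m + 1)) (z (m + 1)) / 2 \<le> Kinv.form (z 0) (z 0) / 2"
    unfolding sum.lessThan_Suc by linarith
  then show ?case by (simp only: Suc_eq_plus1)
qed

text \<open>The sum and the flux at every level are read off from the energy estimate; the other fields follow the flux
  level by level. The modulus of \<open>k_max\<close> makes the nonnegativity of the constant evident.\<close>

lemma fixed_stress_bound:
  assumes sol: "fixed_stress_solution \<Omega> K A \<alpha> c0 dt N Xh Vh Qh Zh Wh \<sigma> u \<gamma> z p" and dt: "0 < dt"
    and c0: "0 \<le> c0" and N: "0 < N"
  defines "D \<equiv> C_d\<^sup>2 / k_min"
  defines "M \<equiv> \<bar>k_max\<bar> + D + (1 + 4 * C_el\<^sup>2 * a_max) * (a_max * CARD('d) * D)"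
  shows "(\<Sum>n<N. c0 / dt * (l2norm \<Omega> (\<lambda>x. p (n + 1) x - p n x))\<^sup>2)
    + (MAX n\<in>{..<N}. (l2norm \<Omega> (z (n + 1)))\<^sup>2 + (l2norm \<Omega> (p (n + 1)))\<^sup>2
        + A.form (\<sigma> (n + 1)) (\<sigma> (n + 1)) + (l2norm \<Omega> (u (n + 1)))\<^sup>2 + (l2norm \<Omega> (\<gamma> (n + 1)))\<^sup>2)
    \<le> (1 / 2 + M) / k_min * (l2norm \<Omega> (z 0))\<^sup>2"
proof -
  have stat: "stationary (\<sigma> n) (u n) (\<gamma> n) (z n) (p n)" if "n \<le> N" for n
    using sol that unfolding fixed_stress_solution_def stationary_def by blast
  define S where "S n x = \<sigma> n x - (if n = 0 then \<sigma> 0 else \<sigma> (n - 1)) x" for n x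
  let ?sum = "\<lambda>m. \<Sum>n<m. c0 / dt * (l2norm \<Omega> (\<lambda>x. p (n + 1) x - p n x))\<^sup>2"
  let ?k = "\<lambda>n. Kinv.form (z n) (z n)"
  have S: "0 \<le> A.form (S m) (S m) / (2 * dt)" if "m \<le> N" for m
  proof -
    have "S m \<in> L2 \<Omega>"
      unfolding S_def using stationaryD(1)[OF stat] that by (intro L2_diff) auto
    then show ?thesis using A.form_nonneg dt by simp
  qed
  have est: "?sum m + A.form (S m) (S m) / (2 * dt) + ?k m / 2 \<le> ?k 0 / 2" if "m \<le> N" for m
    using energy_estimate[OF sol dt that] unfolding S_def .
  have sum: "?sum N \<le> ?k 0 / 2"
    using est[of N] S[of N] Kinv.form_nonneg[OF stationaryD(4)[OF stat], of N] by simp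
  have "0 \<le> ?sum m" for m using c0 dt by (intro sum_nonneg mult_nonneg_nonneg) auto
  then have k: "?k m \<le> ?k 0" if "m \<le> N" for m
    using est[OF that] S[OF that] by (smt (verit) field_sum_of_halves)
  have "0 < k_min" using Kinv.c_pos by simp
  then have D: "0 \<le> D" by (simp add: D_def)
  have "0 \<le> M" unfolding M_def using D A.c_pos by (intro add_nonneg_nonneg mult_nonneg_nonneg) auto
  have M: "(l2norm \<Omega> (z (n + 1)))\<^sup>2 + (l2norm \<Omega> (p (n + 1)))\<^sup>2
        + A.form (\<sigma> (n + 1)) (\<sigma> (n + 1)) + (l2norm \<Omega> (u (n + 1)))\<^sup>2 + (l2norm \<Omega> (\<gamma> (n + 1)))\<^sup>2 \<le> M * ?k 0"
    if "n < N" for n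
  proof -
    have n: "n + 1 \<le> N" using that by simp
    note stationary_bound[OF stat[OF n]]
    also have "(k_max + C_d\<^sup>2 / k_min + (1 + 4 * C_el\<^sup>2 * a_max) * (a_max * CARD('d) * (C_d\<^sup>2 / k_min))) * ?k (n + 1)
        \<le> M * ?k (n + 1)"
      unfolding M_def D_def using Kinv.form_nonneg[OF stationaryD(4)[OF stat[OF n]]]
      by (intro mult_right_mono) auto
    also have "\<dots> \<le> M * ?k 0" using k[OF n] \<open>0 \<le> M\<close> by (intro mult_left_mono)
    finally show ?thesis .
  qed
  have "?sum N + (MAX n\<in>{..<N}. (l2norm \<Omega> (z (n + 1)))\<^sup>2 + (l2norm \<Omega> (p (n + 1)))\<^sup>2
        + A.form (\<sigma> (n + 1)) (\<sigma> (n + 1)) + (l2norm \<Omega> (u (n + 1)))\<^sup>2 + (l2norm \<Omega> (\<gamma> (n + 1)))\<^sup>2)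
      \<le> ?k 0 / 2 + M * ?k 0"
    using N M by (intro add_mono sum) (auto simp: lessThan_empty_iff)
  also have "\<dots> = (1 / 2 + M) * ?k 0" by (simp add: distrib_right)
  also have "\<dots> \<le> (1 / 2 + M) * (1 / k_min * (l2norm \<Omega> (z 0))\<^sup>2)"
    using \<open>0 \<le> M\<close> by (intro mult_left_mono Kinv.form_le stationaryD(4)[OF stat]) auto
  finally show ?thesis by simp
qed

end

section \<open>The bound uniform in the discretization\<close>

lemma fe_space_diff:
  assumes "fe_space \<Omega> \<T> S" "f \<in> S" "g \<in> S"
  shows "(\<lambda>x. f x - g x) \<in> S"
proof -
  have add: "\<And>f g. f \<in> S \<Longrightarrow> g \<in> S \<Longrightarrow> (\<lambda>x. f x + g x) \<in> S" and sc: "\<And>c f. f \<in> S \<Longrightarrow> (\<lambda>x. c *\<^sub>R f x) \<in> S"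
    using assms(1) unfolding fe_space_def by blast+
  show ?thesis using add[OF assms(2) sc[OF assms(3), of "-1"]] by simp
qed

theorem theorem4p2:
  fixes \<Omega> \<Gamma>Du \<Gamma>N\<sigma> \<Gamma>Dp \<Gamma>Nz :: "(real^'d) set"
    and K :: "real^'d \<Rightarrow> real^'d^'d"
    and \<alpha> T a_max k_min k_max :: real
    and H :: "real set"
    and \<T> :: "real \<Rightarrow> (real^'d) set set"
    and Xh :: "real \<Rightarrow> (real^'d \<Rightarrow> real^'d^'d) set"
    and Vh :: "real \<Rightarrow> (real^'d \<Rightarrow> real^'d) set"
    and Qh :: "real \<Rightarrow> (real^'d \<Rightarrow> real^'d^'d) set"
    and Zh :: "real \<Rightarrow> (real^'d \<Rightarrow> real^'d) set"
    and Wh :: "real \<Rightarrow> (real^'d \<Rightarrow> real) set"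
  assumes dim: "CARD('d) = 2 \<or> CARD('d) = 3"
    and domain: "lipschitz_polygonal_domain \<Omega>" "simply_connected \<Omega>"
    and boundary: "frontier \<Omega> = \<Gamma>Du \<union> \<Gamma>N\<sigma>" "frontier \<Omega> = \<Gamma>Dp \<union> \<Gamma>Nz"
    and permeability: "permeability_tensor \<Omega> K" "permeability_bounds \<Omega> \<Gamma>Nz K k_min k_max"
    and alpha: "0 < \<alpha>" "\<alpha> \<le> 1"
    and final_time: "0 < T"
    and mesh: "\<And>h. h \<in> H \<Longrightarrow> 0 < h \<and> partition_of_size \<Omega> h (\<T> h)"
      "shape_regular H \<T>" "quasi_uniform H \<T>"
    and fe_spaces: "\<And>h. h \<in> H \<Longrightarrow> fe_space \<Omega> (\<T> h) (Xh h) \<and> Xh h \<subseteq> stress_space \<Omega> \<Gamma>N\<sigma>"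
      "\<And>h. h \<in> H \<Longrightarrow> fe_space \<Omega> (\<T> h) (Vh h) \<and> Vh h \<subseteq> L2 \<Omega>"
      "\<And>h. h \<in> H \<Longrightarrow> fe_space \<Omega> (\<T> h) (Qh h) \<and> Qh h \<subseteq> rotation_space \<Omega>"
      "\<And>h. h \<in> H \<Longrightarrow> fe_space \<Omega> (\<T> h) (Zh h) \<and> Zh h \<subseteq> velocity_space \<Omega> \<Gamma>Nz"
      "\<And>h. h \<in> H \<Longrightarrow> fe_space \<Omega> (\<T> h) (Wh h) \<and> Wh h \<subseteq> L2 \<Omega>"
    and infsup: "\<exists>C>0. \<forall>h\<in>H. infsup_elasticity \<Omega> C (Xh h) (Vh h) (Qh h)"
      "\<exists>C>0. \<forall>h\<in>H. infsup_darcy \<Omega> C (Zh h) (Wh h)"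
  shows "\<exists>C::real. \<forall>h\<in>H. \<forall>N>0. \<forall>c0\<ge>0. \<forall>a_min A dt \<sigma> u \<gamma> z p.
     compliance_tensor \<Omega> A \<and> compliance_bounds \<Omega> \<Gamma>N\<sigma> A a_min a_max \<and> dt = T / real N \<and>
     fixed_stress_solution \<Omega> K A \<alpha> c0 dt N (Xh h) (Vh h) (Qh h) (Zh h) (Wh h) \<sigma> u \<gamma> z p \<longrightarrow>
     (\<Sum>n<N. c0 / dt * (l2norm \<Omega> (\<lambda>x. p (n + 1) x - p n x))\<^sup>2)
     + (MAX n\<in>{..<N}. (l2norm \<Omega> (z (n + 1)))\<^sup>2 + (l2norm \<Omega> (p (n + 1)))\<^sup>2
          + (l2norm \<Omega> (\<lambda>x. op_sqrt (A x) (\<sigma> (n + 1) x)))\<^sup>2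
          + (l2norm \<Omega> (u (n + 1)))\<^sup>2 + (l2norm \<Omega> (\<gamma> (n + 1)))\<^sup>2)
     \<le> C * (l2norm \<Omega> (z 0))\<^sup>2"

proof -
  have \<Omega>: "open \<Omega>" "bounded \<Omega>" using domain(1) by (auto simp: lipschitz_polygonal_domain_def)
  obtain C_el C_d where C_el: "0 < C_el" "\<And>h. h \<in> H \<Longrightarrow> infsup_elasticity \<Omega> C_el (Xh h) (Vh h) (Qh h)"
    and C_d: "0 < C_d" "\<And>h. h \<in> H \<Longrightarrow> infsup_darcy \<Omega> C_d (Zh h) (Wh h)"
    using infsup by blast
  define D where "D = C_d\<^sup>2 / k_min"
  define M where "M = \<bar>k_max\<bar> + D + (1 + 4 * C_el\<^sup>2 * a_max) * (a_max * CARD('d) * D)"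
  show ?thesis
  proof (intro exI[of _ "(1 / 2 + M) / k_min"] ballI allI impI, elim conjE)
    fix h N c0 a_min A dt \<sigma> u \<gamma> z p
    assume h: "h \<in> H" and N: "0 < (N::nat)" and c0: "(0::real) \<le> c0"
      and A: "compliance_tensor \<Omega> A" "compliance_bounds \<Omega> \<Gamma>N\<sigma> A a_min a_max"
      and dt: "dt = T / real N"
      and sol: "fixed_stress_solution \<Omega> K A \<alpha> c0 dt N (Xh h) (Vh h) (Qh h) (Zh h) (Wh h) \<sigma> u \<gamma> z p"
    have dt0: "0 < dt" using dt N final_time by simp
    note cfA = compliance_coefficient_field[OF \<Omega> A]
    note cfK = inverse_permeability[OF \<Omega> permeability]
    interpret biot_discretization \<Omega> A a_max K k_min \<Gamma>N\<sigma> \<Gamma>Nz \<alpha> C_el C_d k_max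
      "Xh h" "Vh h" "Qh h" "Zh h" "Wh h"
    proof (rule biot_discretization.intro[OF cfA cfK(1)], unfold_locales)
      show "Xh h \<subseteq> stress_space \<Omega> \<Gamma>N\<sigma>" "Vh h \<subseteq> L2 \<Omega>" "Zh h \<subseteq> velocity_space \<Omega> \<Gamma>Nz" "Wh h \<subseteq> L2 \<Omega>"
        using fe_spaces[OF h] by auto
      show "Qh h \<subseteq> L2 \<Omega>" using fe_spaces(3)[OF h] by (auto simp: rotation_space_def)
      show "(\<lambda>x. p x - q x) \<in> Wh h" if "p \<in> Wh h" "q \<in> Wh h" for p q
        using fe_space_diff fe_spaces(5)[OF h] that by blast
      show "0 < \<alpha>" "\<alpha> \<le> 1" by (rule alpha)+
      show "0 < C_el" "0 < C_d" by (rule C_el C_d)+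
      show "infsup_elasticity \<Omega> C_el (Xh h) (Vh h) (Qh h)" by (rule C_el(2)[OF h])
      show "infsup_darcy \<Omega> C_d (Zh h) (Wh h)" by (rule C_d(2)[OF h])
      show "(l2norm \<Omega> z)\<^sup>2 \<le> k_max * coefficient_field.form \<Omega> (\<lambda>x v. matrix_inv (K x) *v v) z z"
        if "z \<in> L2 \<Omega>" for z by (rule cfK(2)[OF that])
    qed
    let ?E = "\<lambda>a n. (l2norm \<Omega> (z (n + 1)))\<^sup>2 + (l2norm \<Omega> (p (n + 1)))\<^sup>2 + a n
          + (l2norm \<Omega> (u (n + 1)))\<^sup>2 + (l2norm \<Omega> (\<gamma> (n + 1)))\<^sup>2"
    let ?s = "\<lambda>n. (l2norm \<Omega> (\<lambda>x. op_sqrt (A x) (\<sigma> (n + 1) x)))\<^sup>2"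
    let ?a = "\<lambda>n. A.form (\<sigma> (n + 1)) (\<sigma> (n + 1))"
    have "?s n \<le> ?a n" if "n < N" for n
    proof -
      have "\<sigma> (n + 1) \<in> stress_space \<Omega> \<Gamma>N\<sigma>"
        using sol Xh Suc_leI[OF that] unfolding fixed_stress_solution_def Suc_eq_plus1 by blast
      from op_sqrt_stress_norm_le[OF \<Omega> A this cfA] show ?thesis unfolding A.form_def .
    qed
    then have le: "?E ?s n \<le> ?E ?a n" if "n < N" for n using that by simp
    have "(MAX n\<in>{..<N}. ?E ?s n) \<le> (MAX n\<in>{..<N}. ?E ?a n)"
    proof (rule Max.boundedI)
      fix y assume "y \<in> ?E ?s ` {..<N}"
      then obtain n where n: "n < N" "y = ?E ?s n" by blast
      have "y \<le> ?E ?a n" unfolding n(2) by (rule le[OF n(1)])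
      also have "\<dots> \<le> (MAX n\<in>{..<N}. ?E ?a n)"
        by (rule Max_ge[OF finite_imageI[OF finite_lessThan] imageI]) (use n(1) in simp)
      finally show "y \<le> (MAX n\<in>{..<N}. ?E ?a n)" .
    qed (use N in auto)
    with fixed_stress_bound[OF sol dt0 c0 N, folded D_def, folded M_def]
    show "(\<Sum>n<N. c0 / dt * (l2norm \<Omega> (\<lambda>x. p (n + 1) x - p n x))\<^sup>2) + (MAX n\<in>{..<N}. ?E ?s n)
        \<le> (1 / 2 + M) / k_min * (l2norm \<Omega> (z 0))\<^sup>2"
      by linarith
  qed
qed

end
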